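(* A bornological universe $(X,\mathcal{B})$ is Hausdorff uniformizable and realcompact if and only if it is isomorphic to a closed subspace of a product of real lines.
   Context: A bornology on a set $X$ is a set $\mathcal{B}\subseteq 2^X$ such that $\{x\}\in\mathcal{B}$ for each $x\in X$; $B\in\mathcal{B}$ and $A\subseteq B$ imply $A\in\mathcal{B}$; and $A\cup B\in\mathcal{B}$ whenever $A,B\in\mathcal{B}$. Elements of $\mathcal{B}$ are called bounded sets. A bornological universe $(X,\mathcal{B})$ is a topological space $X$ endowed with a bornology $\mathcal{B}$ on its underlying set. The morphisms are the continuous maps that send bounded sets to bounded sets; an isomorphism is a bijective morphism whose inverse is a morphism. A subset $B$ of a uniform space $(X,\mathcal{U})$ is bounded in the sense of Bourbaki if for each $U\in\mathcal{U}$ there are $n\in\mathbb{N}$ and a finite set $K\subseteq X$ with $B\subseteq U^n(K)$, where $U^n$ is the $n$-fold composition of $U$. $(X,\mathcal{B})$ is uniformizable if there is a uniformity $\mathcal{U}$ on $X$ whose underlying topology is the topology of $X$ and such that $\mathcal{B}$ is exactly the set of subsets of $X$ that are bounded in the sense of Bourbaki for $\mathcal{U}$. It is Hausdorff uniformizable if it is uniformizable and $X$ is Hausdorff; then $X$ is Tychonoff (completely regular and Hausdorff). $\mathcal{C}_{\mathcal{B}}(X)$ is the set of all continuous real valued maps on $X$ that are bounded on every element of $\mathcal{B}$. For $X$ Tychonoff and a continuous $f:X\to\mathbb{R}$, $f^{\beta}$ denotes the unique continuous map from the Stone–Čech compactification $\beta(X)$ to the one-point compactification $\mathbb{R}\cup\{\infty\}$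 whose restriction to $X$ is $f$. Put $\upsilon_{\mathcal{B}}(X)=\{x\in\beta(X)\mid \forall f\in\mathcal{C}_{\mathcal{B}}(X): f^{\beta}(x)\neq\infty\}$, a subspace of $\beta(X)$ containing $X$. $(X,\mathcal{B})$ is realcompact if $\upsilon_{\mathcal{B}}(X)=X$. The real line is the bornological universe $\mathbb{R}$ with its usual topology and its usual bounded sets. A product of bornological universes $(X_i,\mathcal{B}_i)_{i\in I}$ carries the product topology and the bornology of all sets $B\subseteq\prod_{i\in I}X_i$ for which every projection $\pi_i(B)$ is in $\mathcal{B}_i$. A (closed) subspace $Y$ of a bornological universe is a (closed) subset with the subspace topology and the bornology of all subsets of $Y$ that are bounded in the whole space. *)

theory Defs
  imports "HOL-Analysis.Analysis"
begin

section \<open>Bornological universes\<close>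

definition bornology_on :: "'a set \<Rightarrow> 'a set set \<Rightarrow> bool" where
  "bornology_on S \<B> \<longleftrightarrow>
     \<B> \<subseteq> Pow S \<and>
     (\<forall>x\<in>S. {x} \<in> \<B>) \<and>
     (\<forall>B\<in>\<B>. \<forall>A. A \<subseteq> B \<longrightarrow> A \<in> \<B>) \<and>
     (\<forall>A\<in>\<B>. \<forall>B\<in>\<B>. A \<union> B \<in> \<B>)"

definition bornological_universe :: "'a topology \<Rightarrow> 'a set set \<Rightarrow> bool" where
  "bornological_universe X \<B> \<longleftrightarrow> bornology_on (topspace X) \<B>"

definition bornological_morphism ::
    "'a topology \<Rightarrow> 'a set set \<Rightarrow> 'b topology \<Rightarrow> 'b set set \<Rightarrow> ('a \<Rightarrow> 'b) \<Rightarrow> bool" where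
  "bornological_morphism X \<B> Y \<C> f \<longleftrightarrow> continuous_map X Y f \<and> (\<forall>B\<in>\<B>. f ` B \<in> \<C>)"

definition bornological_isomorphism ::
    "'a topology \<Rightarrow> 'a set set \<Rightarrow> 'b topology \<Rightarrow> 'b set set \<Rightarrow> ('a \<Rightarrow> 'b) \<Rightarrow> bool" where
  "bornological_isomorphism X \<B> Y \<C> f \<longleftrightarrow>
     bij_betw f (topspace X) (topspace Y) \<and>
     bornological_morphism X \<B> Y \<C> f \<and>
     bornological_morphism Y \<C> X \<B> (inv_into (topspace X) f)"

definition bornologically_isomorphic ::
    "'a topology \<Rightarrow> 'a set set \<Rightarrow> 'b topology \<Rightarrow> 'b set set \<Rightarrow> bool" where
  "bornologically_isomorphic X \<B> Y \<C> \<longleftrightarrow> (\<exists>f. bornological_isomorphism X \<B> Y \<C> f)"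

definition subspace_bornology :: "'a set set \<Rightarrow> 'a set \<Rightarrow> 'a set set" where
  "subspace_bornology \<B> S = {B \<in> \<B>. B \<subseteq> S}"

definition product_bornology ::
    "('i \<Rightarrow> 'a topology) \<Rightarrow> ('i \<Rightarrow> 'a set set) \<Rightarrow> 'i set \<Rightarrow> ('i \<Rightarrow> 'a) set set" where
  "product_bornology X \<B> I =
     {B. B \<subseteq> topspace (product_topology X I) \<and> (\<forall>i\<in>I. (\<lambda>x. x i) ` B \<in> \<B> i)}"

lemma bornology_on_subspace:
  assumes "bornology_on S \<B>" "T \<subseteq> S"
  shows "bornology_on T (subspace_bornology \<B> T)"
  using assms unfolding bornology_on_def subspace_bornology_def
  by (intro conjI ballI allI impI) (auto simp: subset_iff)

lemma bornology_on_product: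
  assumes "\<And>i. i \<in> I \<Longrightarrow> bornology_on (topspace (X i)) (\<B> i)"
  shows "bornology_on (topspace (product_topology X I)) (product_bornology X \<B> I)"
proof -
  let ?P = "topspace (product_topology X I)" and ?C = "product_bornology X \<B> I"
  have "{x} \<in> ?C" if "x \<in> ?P" for x
    using that assms by (auto simp: product_bornology_def bornology_on_def PiE_iff)
  moreover have "A \<in> ?C" if "B \<in> ?C" "A \<subseteq> B" for A B
  proof -
    have "(\<lambda>x. x i) ` A \<in> \<B> i" if "i \<in> I" for i
      using assms[OF that] that \<open>A \<subseteq> B\<close> \<open>B \<in> ?C\<close>
      unfolding product_bornology_def bornology_on_def by (metis (mono_tags, lifting) image_mono mem_Collect_eq)
    with that show ?thesis
      unfolding product_bornology_def by blast
  qed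
  moreover have "A \<union> B \<in> ?C" if "A \<in> ?C" "B \<in> ?C" for A B
    using that assms by (simp add: product_bornology_def bornology_on_def image_Un)
  moreover have "?C \<subseteq> Pow ?P"
    unfolding product_bornology_def by blast
  ultimately show ?thesis
    unfolding bornology_on_def by blast
qed

section \<open>Uniformizability\<close>

text \<open>Uniformities are given by their entourages.  The library class of uniform spaces fixes one
  uniformity on a whole type, whereas here the uniformity on a carrier set is quantified over.\<close>

definition is_uniformity :: "'a set \<Rightarrow> 'a rel set \<Rightarrow> bool" where
  "is_uniformity S \<U> \<longleftrightarrow>
     S \<times> S \<in> \<U> \<and>
     (\<forall>U\<in>\<U>. Id_on S \<subseteq> U \<and> U \<subseteq> S \<times> S) \<and>
     (\<forall>U\<in>\<U>. \<forall>V. U \<subseteq> V \<and> V \<subseteq> S \<times> S \<longrightarrow> V \<in> \<U>) \<and>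
     (\<forall>U\<in>\<U>. \<forall>V\<in>\<U>. U \<inter> V \<in> \<U>) \<and>
     (\<forall>U\<in>\<U>. U\<inverse> \<in> \<U>) \<and>
     (\<forall>U\<in>\<U>. \<exists>V\<in>\<U>. V O V \<subseteq> U)"

definition uniformity_induces :: "'a rel set \<Rightarrow> 'a topology \<Rightarrow> bool" where
  "uniformity_induces \<U> X \<longleftrightarrow>
     (\<forall>W. openin X W \<longleftrightarrow> W \<subseteq> topspace X \<and> (\<forall>x\<in>W. \<exists>U\<in>\<U>. U `` {x} \<subseteq> W))"

definition bourbaki_bounded :: "'a set \<Rightarrow> 'a rel set \<Rightarrow> 'a set \<Rightarrow> bool" where
  "bourbaki_bounded S \<U> B \<longleftrightarrow>
     B \<subseteq> S \<and> (\<forall>U\<in>\<U>. \<exists>n K. finite K \<and> K \<subseteq> S \<and> B \<subseteq> (U ^^ n) `` K)"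

definition uniformizable :: "'a topology \<Rightarrow> 'a set set \<Rightarrow> bool" where
  "uniformizable X \<B> \<longleftrightarrow>
     (\<exists>\<U>. is_uniformity (topspace X) \<U> \<and> uniformity_induces \<U> X \<and>
          \<B> = {B. bourbaki_bounded (topspace X) \<U> B})"

definition Hausdorff_uniformizable :: "'a topology \<Rightarrow> 'a set set \<Rightarrow> bool" where
  "Hausdorff_uniformizable X \<B> \<longleftrightarrow> uniformizable X \<B> \<and> Hausdorff_space X"

section \<open>The Stone--Cech compactification\<close>

text \<open>The compactification is the closure of the image of \<open>X\<close> under evaluation in the cube
  indexed by all continuous maps from \<open>X\<close> to the unit interval.  Extensionality selects one
  representative for each such map.\<close>

definition unit_maps :: "'a topology \<Rightarrow> ('a \<Rightarrow> real) set" where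
  "unit_maps X = {f \<in> extensional (topspace X). continuous_map X (top_of_set {0..1}) f}"

definition unit_cube :: "'a topology \<Rightarrow> (('a \<Rightarrow> real) \<Rightarrow> real) topology" where
  "unit_cube X = product_topology (\<lambda>f. top_of_set {0..1}) (unit_maps X)"

definition stone_cech_emb :: "'a topology \<Rightarrow> 'a \<Rightarrow> ('a \<Rightarrow> real) \<Rightarrow> real" where
  "stone_cech_emb X x = (\<lambda>f\<in>unit_maps X. f x)"

definition stone_cech :: "'a topology \<Rightarrow> (('a \<Rightarrow> real) \<Rightarrow> real) topology" where
  "stone_cech X =
     subtopology (unit_cube X) (unit_cube X closure_of (stone_cech_emb X ` topspace X))"

text \<open>The map \<open>f\<^sup>\<beta>\<close>.  In the one-point compactification of the real line, \<open>None\<close> is the point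
  at infinity.\<close>

definition stone_cech_ext ::
    "'a topology \<Rightarrow> ('a \<Rightarrow> real) \<Rightarrow> (('a \<Rightarrow> real) \<Rightarrow> real) \<Rightarrow> real option" where
  "stone_cech_ext X f =
     (THE g. g \<in> extensional (topspace (stone_cech X)) \<and>
        continuous_map (stone_cech X) (Alexandroff_compactification euclideanreal) g \<and>
        (\<forall>x\<in>topspace X. g (stone_cech_emb X x) = Some (f x)))"

section \<open>Realcompactness\<close>

definition bounded_continuous_maps :: "'a topology \<Rightarrow> 'a set set \<Rightarrow> ('a \<Rightarrow> real) set" where
  "bounded_continuous_maps X \<B> =
     {f. continuous_map X euclideanreal f \<and> (\<forall>B\<in>\<B>. bounded (f ` B))}"

definition upsilon :: "'a topology \<Rightarrow> 'a set set \<Rightarrow> (('a \<Rightarrow> real) \<Rightarrow> real) set" where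
  "upsilon X \<B> =
     {p \<in> topspace (stone_cech X).
        \<forall>f\<in>bounded_continuous_maps X \<B>. stone_cech_ext X f p \<noteq> None}"

definition bornologically_realcompact :: "'a topology \<Rightarrow> 'a set set \<Rightarrow> bool" where
  "bornologically_realcompact X \<B> \<longleftrightarrow> upsilon X \<B> = stone_cech_emb X ` topspace X"

section \<open>Products of real lines\<close>

definition real_line_bornology :: "real set set" where
  "real_line_bornology = {B. bounded B}"

definition real_lines :: "'i set \<Rightarrow> ('i \<Rightarrow> real) topology" where
  "real_lines I = product_topology (\<lambda>i. euclideanreal) I"

definition real_lines_bornology :: "'i set \<Rightarrow> ('i \<Rightarrow> real) set set" where
  "real_lines_bornology I =
     product_bornology (\<lambda>i. euclideanreal) (\<lambda>i. real_line_bornology) I"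

text \<open>The index type \<open>'i\<close> is a parameter.  A formula cannot quantify over types, so an existential
  statement about index sets is made over \<open>('a \<Rightarrow> real) set\<close>, which can index a product by any set of
  real valued maps on \<open>X\<close>, and a statement about all index sets is made with \<open>'i\<close> arbitrary.\<close>

definition iso_closed_subspace_of_real_lines :: "'i set \<Rightarrow> 'a topology \<Rightarrow> 'a set set \<Rightarrow> bool" where
  "iso_closed_subspace_of_real_lines I X \<B> \<longleftrightarrow>
     (\<exists>S. closedin (real_lines I) S \<and>
          bornologically_isomorphic X \<B>
            (subtopology (real_lines I) S) (subspace_bornology (real_lines_bornology I) S))"

section \<open>Well-definedness of the Stone--Cech extension\<close>

lemma compact_Hausdorff_unit_cube: "compact_space (unit_cube X)" "Hausdorff_space (unit_cube X)"
proof -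
  have "compact_space (top_of_set {0..1::real})"
    by (intro compact_space_subtopology) simp
  then show "compact_space (unit_cube X)"
    unfolding unit_cube_def by (simp add: compact_space_product_topology)
  have "Hausdorff_space (top_of_set {0..1::real})"
    by (intro Hausdorff_space_subtopology Hausdorff_space_euclidean)
  then show "Hausdorff_space (unit_cube X)"
    unfolding unit_cube_def by (simp add: Hausdorff_space_product_topology)
qed

lemma stone_cech_emb_in_cube:
  "stone_cech_emb X ` topspace X \<subseteq> topspace (unit_cube X)"
proof
  fix p assume "p \<in> stone_cech_emb X ` topspace X"
  then obtain x where x: "x \<in> topspace X" and p: "p = stone_cech_emb X x"
    by blast
  have "f x \<in> {0..1}" if "f \<in> unit_maps X" for f
    using that x by (auto simp: unit_maps_def continuous_map_in_subtopology Pi_iff)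
  then show "p \<in> topspace (unit_cube X)"
    by (simp add: p stone_cech_emb_def unit_cube_def)
qed

lemma compact_Hausdorff_stone_cech: "compact_space (stone_cech X)" "Hausdorff_space (stone_cech X)"
  unfolding stone_cech_def
  by (rule compact_space_subtopology closedin_compact_space compact_Hausdorff_unit_cube
        closedin_closure_of Hausdorff_space_subtopology)+

lemma stone_cech_dense: "stone_cech X closure_of (stone_cech_emb X ` topspace X) = topspace (stone_cech X)"
proof -
  have "stone_cech_emb X ` topspace X \<subseteq> unit_cube X closure_of (stone_cech_emb X ` topspace X)"
    by (simp add: closure_of_subset stone_cech_emb_in_cube)
  then show ?thesis
    by (simp add: stone_cech_def closure_of_subtopology Int_absorb1 closure_of_subset_topspace
          Int_absorb2)
qed

lemma embedding_map_stone_cech_emb_cube: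
  assumes "completely_regular_space X" "Hausdorff_space X"
  shows "embedding_map X (unit_cube X) (stone_cech_emb X)"
proof -
  have "bounded (f ` topspace X)" if "f \<in> topspace X \<rightarrow> {0..1}" for f :: "'a \<Rightarrow> real"
    using that by (metis bounded_closed_interval bounded_subset image_subset_iff_funcset)
  then have "mspace (submetric (cfunspace X euclidean_metric) {f. f \<in> topspace X \<rightarrow> {0..1}}) = unit_maps X"
    by (auto simp: unit_maps_def continuous_map_in_subtopology)
  with completely_regular_space_cube_embedding_explicit[OF assms] show ?thesis
    by (simp add: unit_cube_def stone_cech_emb_def[abs_def])
qed

lemma embedding_map_stone_cech_emb:
  assumes "completely_regular_space X" "Hausdorff_space X"
  shows "embedding_map X (stone_cech X) (stone_cech_emb X)"
  unfolding stone_cech_def embedding_map_in_subtopology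
  using embedding_map_stone_cech_emb_cube[OF assms] stone_cech_emb_in_cube[of X]
  by (simp add: closure_of_subset)

lemma stone_cech_extension_exists:
  fixes X :: "'a topology" and K :: "'b topology"
  assumes K: "compact_space K" "Hausdorff_space K" and f: "continuous_map X K f"
  obtains g where "continuous_map (stone_cech X) K g" "\<And>x. x \<in> topspace X \<Longrightarrow> g (stone_cech_emb X x) = f x"
proof -
  define e where "e = stone_cech_emb K"
  have "completely_regular_space K"
    using K by (simp add: compact_Hausdorff_or_regular_imp_normal_space normal_imp_completely_regular_space)
  then have "embedding_map K (unit_cube K) e"
    using K(2) unfolding e_def by (rule embedding_map_stone_cech_emb_cube)
  then obtain e' where e': "homeomorphic_maps K (subtopology (unit_cube K) (e ` topspace K)) e e'"
    by (force simp: embedding_map_def homeomorphic_map_maps)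
  have conte: "continuous_map K (unit_cube K) e"
    using e' by (simp add: homeomorphic_maps_def continuous_map_in_subtopology)
  define pull where "pull h = restrict (h \<circ> f) (topspace X)" for h :: "'b \<Rightarrow> real"
  have pull: "pull h \<in> unit_maps X" if "h \<in> unit_maps K" for h
  proof -
    have "continuous_map X (top_of_set {0..1}) (h \<circ> f)"
      using that f unfolding unit_maps_def by (blast intro: continuous_map_compose)
    then have "continuous_map X (top_of_set {0..1}) (pull h)"
      unfolding pull_def by (rule continuous_map_eq) simp
    then show ?thesis
      by (simp add: unit_maps_def pull_def)
  qed
  define G where "G p = (\<lambda>h\<in>unit_maps K. p (pull h))" for p :: "('a \<Rightarrow> real) \<Rightarrow> real"
  have contG: "continuous_map (unit_cube X) (unit_cube K) G"
    unfolding unit_cube_def continuous_map_componentwise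
  proof (intro conjI ballI)
    fix h assume h: "h \<in> unit_maps K"
    show "continuous_map (product_topology (\<lambda>f. top_of_set {0..1}) (unit_maps X)) (top_of_set {0..1}) (\<lambda>p. G p h)"
      using h continuous_map_product_projection[OF pull[OF h], of "\<lambda>f. top_of_set {0..1}"]
      by (simp add: G_def)
  qed (simp add: G_def image_subset_iff)
  have Gemb: "G (stone_cech_emb X x) = e (f x)" if "x \<in> topspace X" for x
    using that pull unfolding G_def e_def stone_cech_emb_def by (simp add: pull_def fun_eq_iff)
  have clo: "closedin (unit_cube K) (e ` topspace K)"
    using K(1) conte unfolding compact_space_def
    by (intro compactin_imp_closedin[OF compact_Hausdorff_unit_cube(2)] image_compactin)
  have "G ` (unit_cube X closure_of (stone_cech_emb X ` topspace X))
          \<subseteq> unit_cube K closure_of (G ` stone_cech_emb X ` topspace X)"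
    by (simp add: contG continuous_map_image_closure_subset)
  also have "\<dots> \<subseteq> e ` topspace K"
    using f Gemb by (intro closure_of_minimal clo) (auto simp: continuous_map_def)
  finally have "continuous_map (stone_cech X) (subtopology (unit_cube K) (e ` topspace K)) G"
    unfolding stone_cech_def continuous_map_in_subtopology
    by (auto simp: contG continuous_map_from_subtopology)
  then have "continuous_map (stone_cech X) K (e' \<circ> G)"
    using e' by (meson continuous_map_compose homeomorphic_maps_def)
  moreover have "(e' \<circ> G) (stone_cech_emb X x) = f x" if "x \<in> topspace X" for x
    using that Gemb[OF that] e' f by (auto simp: homeomorphic_maps_def continuous_map_def)
  ultimately show thesis ..
qed

lemma stone_cech_ext_ex1:
  assumes f: "continuous_map X euclideanreal f"
  shows "\<exists>!g. g \<in> extensional (topspace (stone_cech X)) \<and>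
        continuous_map (stone_cech X) (Alexandroff_compactification euclideanreal) g \<and>
        (\<forall>x\<in>topspace X. g (stone_cech_emb X x) = Some (f x))"
proof -
  let ?A = "Alexandroff_compactification euclideanreal"
  have A: "compact_space ?A" "Hausdorff_space ?A"
    by (auto simp: Hausdorff_space_Alexandroff_compactification locally_compact_space_euclidean)
  have "continuous_map X ?A (Some \<circ> f)"
    using f continuous_map_Some continuous_map_compose by blast
  from stone_cech_extension_exists[OF A this] obtain g where
    g: "continuous_map (stone_cech X) ?A g" "\<And>x. x \<in> topspace X \<Longrightarrow> g (stone_cech_emb X x) = Some (f x)"
    by auto
  have sub: "stone_cech_emb X ` topspace X \<subseteq> topspace (stone_cech X)"
    using closure_of_subset[OF stone_cech_emb_in_cube[of X]] stone_cech_emb_in_cube[of X]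
    by (simp add: stone_cech_def)
  show ?thesis
  proof (rule ex_ex1I)
    show "\<exists>g. g \<in> extensional (topspace (stone_cech X)) \<and> continuous_map (stone_cech X) ?A g \<and>
        (\<forall>x\<in>topspace X. g (stone_cech_emb X x) = Some (f x))"
    proof (intro exI conjI ballI)
      show "continuous_map (stone_cech X) ?A (restrict g (topspace (stone_cech X)))"
        using g(1) by (rule continuous_map_eq) simp
      show "restrict g (topspace (stone_cech X)) (stone_cech_emb X x) = Some (f x)"
        if "x \<in> topspace X" for x
        using that g(2) sub by (simp add: image_subset_iff)
    qed simp
  next
    fix g h
    assume g: "g \<in> extensional (topspace (stone_cech X)) \<and> continuous_map (stone_cech X) ?A g \<and>
        (\<forall>x\<in>topspace X. g (stone_cech_emb X x) = Some (f x))"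
      and h: "h \<in> extensional (topspace (stone_cech X)) \<and> continuous_map (stone_cech X) ?A h \<and>
        (\<forall>x\<in>topspace X. h (stone_cech_emb X x) = Some (f x))"
    show "g = h"
    proof (rule extensionalityI[of _ "topspace (stone_cech X)"])
      fix p assume "p \<in> topspace (stone_cech X)"
      then have p: "p \<in> stone_cech X closure_of (stone_cech_emb X ` topspace X)"
        by (simp add: stone_cech_dense)
      show "g p = h p"
        by (rule forall_in_closure_of_eq[OF p A(2)]) (use g h in auto)
    qed (use g h in auto)
  qed
qed

end

theory Submission
  imports Defs
begin

text \<open>
  The coordinates of the embedding are the functions in \<open>\<C>\<^sub>\<B>(X)\<close>, the continuous real functions that
  are bounded on bounded sets, and the three features of an isomorphism with a closed subspace of
  a product of lines correspond to three properties of this family: it determines the topology,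
  it determines the bornology, and its joint image is closed.

  Let \<open>X\<close> be Hausdorff uniformizable and realcompact, and let \<open>e\<close> evaluate a point at all functions
  in \<open>\<C>\<^sub>\<B>(X)\<close>.  A uniform space is completely regular, by a Urysohn argument along the entourages
  (\<open>uniform_Urysohn\<close>), and every function into the unit interval lies in \<open>\<C>\<^sub>\<B>(X)\<close>, so \<open>e\<close> is an
  embedding.  A set that is not bounded in the sense of Bourbaki carries an unbounded function of
  \<open>\<C>\<^sub>\<B>(X)\<close> (\<open>unbounded_function_on_unbounded_set\<close>), so \<open>\<C>\<^sub>\<B>(X)\<close> recognizes the bounded sets.  The
  image of \<open>e\<close> is closed because the maps \<open>f\<^sup>\<beta>\<close> together send \<open>\<beta>(X)\<close> onto a compact set, and
  a limit \<open>s\<close> of points \<open>e(x)\<close> is therefore given by a single point \<open>p\<close> of \<open>\<beta>(X)\<close>, with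
  \<open>f\<^sup>\<beta>(p) = s\<^sub>f\<close> finite for all \<open>f\<close>; realcompactness puts \<open>p\<close> into \<open>X\<close>
  (\<open>realcompact_imp_closedin_real_evaluation\<close>).

  Conversely, let \<open>X\<close> be a closed subspace of a product of lines.  The coordinates generate a
  uniformity that induces the topology.  Its Bourbaki bounded sets are those on which every
  coordinate is bounded (\<open>bourbaki_bounded_initial_uniformity\<close>), because an entourage only
  involves finitely many coordinates and bounded subsets of a finite power of the line are
  totally bounded.  If no \<open>f\<^sup>\<beta>\<close> is infinite at a point \<open>p\<close> of \<open>\<beta>(X)\<close>, the values of the extended
  coordinates at \<open>p\<close> form a point of the product in the closure of \<open>X\<close>, hence a point of \<open>X\<close>, and
  this point is \<open>p\<close> since \<open>\<beta>(X)\<close> is Hausdorff (\<open>closed_subspace_imp_realcompact\<close>).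
\<close>

section \<open>Urysohn functions\<close>

lemma dyadic_between:
  fixes a b :: real
  assumes "0 \<le> a" "a < b" "b \<le> 1"
  obtains r where "r \<in> dyadics \<inter> {0..1}" "a < r" "r < b"
proof -
  obtain n q r where "of_nat q / 2 ^ n \<le> a" "a < of_nat r / 2 ^ n"
      "\<bar>of_nat q / 2 ^ n - of_nat r / 2 ^ n\<bar> < b - a"
    by (rule padic_rational_approximation_straddle_pos_le[of "b - a" 2 a]) (use assms in auto)
  then have r: "of_nat r / 2 ^ n \<in> (dyadics :: real set)" "a < of_nat r / 2 ^ n" "of_nat r / 2 ^ n < b"
    by (auto simp: dyadics_def)
  moreover have "of_nat r / 2 ^ n \<in> {0..1::real}"
    using r assms by (simp only: atLeastAtMost_iff) linarith
  ultimately show thesis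
    using that by blast
qed

text \<open>
  The proof of Urysohn's lemma uses normality only to interpolate between a closed set and an open
  superset.  An abstract relation \<open>R\<close> that can be interpolated therefore yields separating functions
  on spaces that are not normal.
\<close>

lemma Urysohn_strong_inclusion:
  fixes R :: "'a set \<Rightarrow> 'a set \<Rightarrow> bool"
  assumes "R A B"
    and closure_interior: "\<And>A B. R A B \<Longrightarrow> X closure_of A \<subseteq> X interior_of B"
    and interpolate: "\<And>A B. R A B \<Longrightarrow> \<exists>C. R A C \<and> R C B"
    and trans: "\<And>A B C. \<lbrakk>R A B; R B C\<rbrakk> \<Longrightarrow> R A C"
  obtains f :: "'a \<Rightarrow> real" where "continuous_map X (top_of_set {0..1}) f"
    "\<And>x. x \<in> A \<Longrightarrow> f x = 0" "\<And>x. x \<in> topspace X - B \<Longrightarrow> f x = 1"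
proof -
  let ?D = "dyadics \<inter> {0..1::real}"
  have "\<exists>G :: real \<Rightarrow> 'a set. G 0 = A \<and> G 1 = B \<and> (\<forall>r\<in>?D. \<forall>s\<in>?D. r < s \<longrightarrow> R (G r) (G s))"
  proof (rule recursion_on_dyadic_fractions[of R])
    show "R A B" by fact
    show "\<exists>z. R x z \<and> R z y" if "R x y" for x y
      using that by (rule interpolate)
    show "R x z" if "R x y" "R y z" for x y z
      using that by (rule trans)
  qed
  then obtain G :: "real \<Rightarrow> 'a set" where G0: "G 0 = A" and G1: "G 1 = B"
    and G': "\<forall>r\<in>?D. \<forall>s\<in>?D. r < s \<longrightarrow> R (G r) (G s)"
    by (elim exE conjE)
  have G: "R (G r) (G s)" if "r \<in> ?D" "s \<in> ?D" "r < s" for r s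
    using G' that by blast
  have 01: "0 \<in> ?D" "1 \<in> ?D"
    using real_in_dyadics[of 0] real_in_dyadics[of 1] by auto
  have G_sub: "X closure_of G r \<subseteq> X interior_of G s" if "r \<in> ?D" "s \<in> ?D" "r < s" for r s
    using that G closure_interior by blast
  have G_mono: "x \<in> G s" if "x \<in> topspace X" "x \<in> G r" "r \<in> ?D" "s \<in> ?D" "r < s" for x r s
  proof -
    have "x \<in> X closure_of G r"
      using that by (auto simp: in_closure_of)
    then show ?thesis
      using G_sub[of r s] that interior_of_subset[of X "G s"] by blast
  qed
  define f where "f x = Inf (insert 1 {r \<in> ?D. x \<in> G r})" for x
  have bdd: "bdd_below (insert 1 {r \<in> ?D. x \<in> G r})" for x
    by (intro bdd_belowI[of _ 0]) auto
  have f_le: "f x \<le> r" if "r \<in> ?D" "x \<in> G r" for x r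
    unfolding f_def using that by (intro cInf_lower bdd) auto
  have f_le1: "f x \<le> 1" for x
    unfolding f_def by (intro cInf_lower bdd) auto
  have f_ge0: "0 \<le> f x" for x
    unfolding f_def by (intro cInf_greatest) auto
  have f_ge: "r \<le> f x" if "x \<in> topspace X" "r \<in> ?D" "x \<notin> G r" for x r
    unfolding f_def
  proof (rule cInf_greatest)
    fix s assume s: "s \<in> insert 1 {r \<in> ?D. x \<in> G r}"
    show "r \<le> s"
      using s that G_mono[of x s r] by (cases "s = 1") (auto simp: not_le[symmetric])
  qed simp
  have f_lt: "\<exists>s\<in>?D. x \<in> G s \<and> s < a" if "f x < a" "a \<le> 1" for x a
    using that unfolding f_def by (subst (asm) cInf_less_iff[OF _ bdd]) auto
  \<comment> \<open>A sublevel set is a union of interiors and a superlevel set a union of complements of closures,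
    since the dyadic numbers are dense.\<close>
  have openlt: "openin X {x \<in> topspace X. f x < a}" for a
  proof (cases "a \<le> 1")
    case True
    have "\<exists>T. openin X T \<and> x \<in> T \<and> T \<subseteq> {x \<in> topspace X. f x < a}" if x: "x \<in> topspace X" "f x < a" for x
    proof -
      obtain s where s: "s \<in> ?D" "x \<in> G s" "s < a"
        using f_lt[OF x(2) True] by blast
      obtain r where r: "r \<in> ?D" "s < r" "r < a"
        using dyadic_between[of s a] s True by auto
      have "x \<in> X closure_of G s"
        using x(1) s(2) by (auto simp: in_closure_of)
      then have "x \<in> X interior_of G r"
        using G_sub[OF s(1) r(1,2)] by blast
      moreover have "X interior_of G r \<subseteq> {x \<in> topspace X. f x < a}"
        using f_le[OF r(1)] r(3) interior_of_subset[of X "G r"] interior_of_subset_topspace[of X "G r"]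
        by fastforce
      ultimately show ?thesis
        by (meson openin_interior_of)
    qed
    then show ?thesis
      by (subst openin_subopen) blast
  next
    case False
    then have "f x < a" for x
      using f_le1[of x] by linarith
    then show ?thesis by simp
  qed
  have opengt: "openin X {x \<in> topspace X. f x > a}" for a
  proof (cases "a \<ge> 0")
    case True
    have "\<exists>T. openin X T \<and> x \<in> T \<and> T \<subseteq> {x \<in> topspace X. f x > a}" if x: "x \<in> topspace X" "f x > a" for x
    proof -
      obtain s where s: "s \<in> ?D" "a < s" "s < f x"
        using dyadic_between[of a "f x"] x True f_le1 by auto
      obtain r where r: "r \<in> ?D" "a < r" "r < s"
        using dyadic_between[of a s] s True by auto
      have "x \<notin> G s"
        using f_le[OF s(1)] s(3) by force
      then have "x \<in> topspace X - X closure_of G r"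
        using G_sub[OF r(1) s(1) r(3)] x interior_of_subset[of X "G s"] by blast
      moreover have "topspace X - X closure_of G r \<subseteq> {x \<in> topspace X. f x > a}"
        using f_ge[OF _ r(1)] r(2) closure_of_subset_Int[of X "G r"] by fastforce
      ultimately show ?thesis
        by (meson openin_diff openin_topspace closedin_closure_of)
    qed
    then show ?thesis
      by (subst openin_subopen) blast
  next
    case False
    then have "a < f x" for x
      using f_ge0[of x] by linarith
    then show ?thesis by simp
  qed
  show thesis
  proof
    have "f x \<in> {0..1}" for x
      using f_ge0 f_le1 by simp
    with openlt opengt show "continuous_map X (top_of_set {0..1}) f"
      unfolding continuous_map_upper_lower_semicontinuous_lt_gen by blast
    fix x
    show "f x = 0" if "x \<in> A"
      using f_le[OF 01(1), of x] f_ge0[of x] that unfolding G0 by linarith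
    show "f x = 1" if "x \<in> topspace X - B"
      using f_ge[OF _ 01(2), of x] f_le1[of x] that unfolding G1 by (metis DiffD1 DiffD2 antisym)
  qed
qed

section \<open>Continuous functions on a uniform space\<close>

lemma uniformity_symmetric_half:
  assumes "is_uniformity S \<U>" "U \<in> \<U>"
  obtains V where "V \<in> \<U>" "sym V" "V O V \<subseteq> U"
proof -
  obtain W where W: "W \<in> \<U>" "W O W \<subseteq> U"
    using assms unfolding is_uniformity_def by meson
  show thesis
  proof
    show "W \<inter> W\<inverse> \<in> \<U>"
      using assms(1) W(1) unfolding is_uniformity_def by meson
    show "sym (W \<inter> W\<inverse>)"
      by (rule sym_Int_converse)
    show "(W \<inter> W\<inverse>) O (W \<inter> W\<inverse>) \<subseteq> U"
      using W(2) by blast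
  qed
qed

lemma interior_of_uniform:
  assumes unif: "is_uniformity (topspace X) \<U>" and ind: "uniformity_induces \<U> X"
  shows "X interior_of W = {x \<in> topspace X. \<exists>U\<in>\<U>. U `` {x} \<subseteq> W}" (is "_ = ?I")
proof
  show "X interior_of W \<subseteq> ?I"
  proof
    fix x assume x: "x \<in> X interior_of W"
    then obtain U where "U \<in> \<U>" "U `` {x} \<subseteq> X interior_of W"
      using ind openin_interior_of[of X W] unfolding uniformity_induces_def by meson
    then show "x \<in> ?I"
      using x interior_of_subset[of X W] interior_of_subset_topspace[of X W] by blast
  qed
  have "openin X ?I"
    using ind unfolding uniformity_induces_def
  proof (elim allE[of _ ?I] iffD2, intro conjI ballI)
    fix x assume "x \<in> ?I"
    then obtain U where U: "U \<in> \<U>" "U `` {x} \<subseteq> W" by blast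
    obtain V where V: "V \<in> \<U>" "V O V \<subseteq> U"
      using uniformity_symmetric_half[OF unif U(1)] by blast
    have "V \<subseteq> topspace X \<times> topspace X"
      using unif V(1) unfolding is_uniformity_def by meson
    then have "V `` {x} \<subseteq> ?I"
      using U V by blast
    with V(1) show "\<exists>V\<in>\<U>. V `` {x} \<subseteq> ?I" by blast
  qed blast
  moreover have "?I \<subseteq> W"
  proof
    fix x assume "x \<in> ?I"
    then obtain U where "x \<in> topspace X" "U \<in> \<U>" "U `` {x} \<subseteq> W" by blast
    moreover have "Id_on (topspace X) \<subseteq> U"
      using unif \<open>U \<in> \<U>\<close> unfolding is_uniformity_def by meson
    ultimately show "x \<in> W" by blast
  qed
  ultimately show "?I \<subseteq> X interior_of W"
    by (simp add: interior_of_maximal)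
qed

text \<open>
  The relation that \<open>U `` A \<subseteq> B\<close> for some entourage \<open>U\<close> can be interpolated by halving the
  entourage, and it puts the closure of \<open>A\<close> into the interior of \<open>B\<close>.
\<close>

lemma uniform_Urysohn:
  assumes unif: "is_uniformity (topspace X) \<U>" and ind: "uniformity_induces \<U> X"
    and "A \<subseteq> topspace X" "U \<in> \<U>" "U `` A \<subseteq> B"
  obtains f :: "'a \<Rightarrow> real" where "continuous_map X (top_of_set {0..1}) f"
    "\<And>x. x \<in> A \<Longrightarrow> f x = 0" "\<And>x. x \<in> topspace X - B \<Longrightarrow> f x = 1"
proof -
  define R where "R A B \<longleftrightarrow> A \<subseteq> topspace X \<and> (\<exists>U\<in>\<U>. U `` A \<subseteq> B)" for A B
  have sub: "Id_on (topspace X) \<subseteq> U" "U \<subseteq> topspace X \<times> topspace X" if "U \<in> \<U>" for U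
    using that unif unfolding is_uniformity_def by meson+
  have 1: "X closure_of A \<subseteq> X interior_of B" if "R A B" for A B
  proof
    fix x assume x: "x \<in> X closure_of A"
    obtain U where U: "U \<in> \<U>" "U `` A \<subseteq> B"
      using \<open>R A B\<close> by (auto simp: R_def)
    obtain V where V: "V \<in> \<U>" "sym V" "V O V \<subseteq> U"
      using uniformity_symmetric_half[OF unif U(1)] by blast
    have xt: "x \<in> topspace X"
      using x by (simp add: in_closure_of)
    have "x \<in> X interior_of (V `` {x})"
      using V(1) xt by (auto simp: interior_of_uniform[OF unif ind])
    then obtain a where a: "a \<in> A" "a \<in> X interior_of (V `` {x})"
      using x by (meson in_closure_of openin_interior_of)
    then have "(x, a) \<in> V"
      using interior_of_subset by fastforce
    then have "(a, x) \<in> V"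
      using V(2) by (meson symD)
    then have "V `` {x} \<subseteq> B"
      using a(1) V(3) U(2) by blast
    then show "x \<in> X interior_of B"
      using V(1) xt by (auto simp: interior_of_uniform[OF unif ind])
  qed
  have 2: "\<exists>C. R A C \<and> R C B" if "R A B" for A B
  proof -
    obtain U where U: "U \<in> \<U>" "U `` A \<subseteq> B"
      using \<open>R A B\<close> by (auto simp: R_def)
    obtain V where V: "V \<in> \<U>" "sym V" "V O V \<subseteq> U"
      using uniformity_symmetric_half[OF unif U(1)] by blast
    have "R A (V `` A) \<and> R (V `` A) B"
      unfolding R_def using \<open>R A B\<close> U V sub[OF V(1)] by (auto simp: R_def intro!: bexI[of _ V])
    then show ?thesis ..
  qed
  have 3: "R A C" if AB: "R A B" and BC: "R B C" for A B C
  proof -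
    obtain U where U: "U \<in> \<U>" "U `` A \<subseteq> B"
      using AB by (auto simp: R_def)
    obtain V where V: "V \<in> \<U>" "V `` B \<subseteq> C"
      using BC by (auto simp: R_def)
    have "A \<subseteq> B"
      using sub(1)[OF U(1)] AB U(2) unfolding R_def by blast
    then have "V `` A \<subseteq> C"
      using V(2) by blast
    then show ?thesis
      using AB V(1) by (auto simp: R_def)
  qed
  have "R A B"
    using assms by (auto simp: R_def)
  from Urysohn_strong_inclusion[of R, OF this 1 2 3 that] show thesis .
qed

lemma uniform_imp_completely_regular_space:
  assumes unif: "is_uniformity (topspace X) \<U>" and ind: "uniformity_induces \<U> X"
  shows "completely_regular_space X"
  unfolding completely_regular_space_def
proof (intro allI impI)
  fix S x assume Sx: "closedin X S \<and> x \<in> topspace X - S"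
  then have "openin X (topspace X - S)" by blast
  then obtain U where U: "U \<in> \<U>" "U `` {x} \<subseteq> topspace X - S"
    using ind Sx unfolding uniformity_induces_def by meson
  have "{x} \<subseteq> topspace X"
    using Sx by blast
  from uniform_Urysohn[OF unif ind this U]
  obtain f :: "'a \<Rightarrow> real" where f: "continuous_map X (top_of_set {0..1}) f" "f x = 0"
      "\<And>y. y \<in> topspace X - (topspace X - S) \<Longrightarrow> f y = 1"
    by (metis singletonI)
  moreover have "S \<subseteq> topspace X"
    using Sx closedin_subset by blast
  ultimately show "\<exists>f::'a \<Rightarrow> real. continuous_map X (top_of_set {0..1}) f \<and> f x = 0 \<and> f ` S \<subseteq> {1}"
    by (intro exI[of _ f]) auto
qed

section \<open>Unbounded functions on sets that are not Bourbaki bounded\<close>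

lemma relpow_Image_Suc: "(V ^^ Suc n) `` K = V `` ((V ^^ n) `` K)"
  by (simp add: relcomp_Image)

lemma sym_relpow:
  assumes "sym V"
  shows "sym (V ^^ n)"
proof (induction n)
  case 0
  show ?case by (simp add: sym_Id)
next
  case (Suc n)
  have "(V ^^ Suc n)\<inverse> = V\<inverse> O (V ^^ n)\<inverse>"
    by (simp add: converse_relcomp)
  also have "\<dots> = V O V ^^ n"
    using assms Suc unfolding sym_conv_converse_eq by (rule arg_cong2)
  also have "\<dots> = V ^^ Suc n"
    by (metis relpow.simps(2) relpow_commute)
  finally show ?case
    unfolding sym_conv_converse_eq .
qed

text \<open>
  If a symmetric entourage \<open>V\<close> witnesses that \<open>B\<close> is not Bourbaki bounded, points \<open>x\<^sub>n\<close> of \<open>B\<close> can be chosen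
  one after the other outside \<open>A\<^sub>n = V\<^sup>n({x\<^sub>0, \<dots>, x\<^sub>n\<^sub>-\<^sub>1})\<close>.  Growing the exponent along with the
  finite set treats at once a set that reaches arbitrarily far within one \<open>V\<close>-chain component and
  a set that meets infinitely many components.  The function sought counts the layers
  \<open>A\<^sub>n\<close> that a point has left: it is the sum of Urysohn functions that rise from 0 to 1 between
  \<open>A\<^sub>n\<close> and \<open>A\<^sub>n\<^sub>+\<^sub>1\<close>.  The sum is locally finite on the union of the layers, which is closed under
  \<open>V\<close> and hence clopen, so it may be continued by 0.
\<close>

lemma unbounded_function_on_unbounded_set:
  assumes unif: "is_uniformity (topspace X) \<U>" and ind: "uniformity_induces \<U> X"
    and B: "B \<subseteq> topspace X" "\<not> bourbaki_bounded (topspace X) \<U> B"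
  obtains F :: "'a \<Rightarrow> real" where "continuous_map X euclideanreal F"
    "\<And>D. bourbaki_bounded (topspace X) \<U> D \<Longrightarrow> bounded (F ` D)" "\<not> bounded (F ` B)"
proof -
  let ?S = "topspace X"
  obtain U where U: "U \<in> \<U>"
      and not_covered: "\<And>n K. \<lbrakk>finite K; K \<subseteq> ?S\<rbrakk> \<Longrightarrow> \<not> B \<subseteq> (U ^^ n) `` K"
    using B unfolding bourbaki_bounded_def by meson
  define V where "V = U \<inter> U\<inverse>"
  have "V \<in> \<U>"
    using unif U unfolding V_def is_uniformity_def by meson
  moreover have "sym V" "V \<subseteq> U"
    unfolding V_def by (rule sym_Int_converse, rule Int_lower1)
  ultimately have V: "V \<in> \<U>" "sym V" "V \<subseteq> U" .
  have V_refl: "Id_on ?S \<subseteq> V" and V_sub: "V \<subseteq> ?S \<times> ?S"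
    using unif V(1) unfolding is_uniformity_def by meson+
  have "V ^^ n \<subseteq> U ^^ n" for n
    using V(3) by (induction n) (auto intro!: relcomp_mono)
  then have escape: "\<exists>x. x \<in> B - (V ^^ n) `` K" if "finite K" "K \<subseteq> ?S" for n K
    using not_covered[OF that, of n] by blast
  define pick where "pick n K = (SOME x. x \<in> B - (V ^^ n) `` K)" for n K
  have pick: "pick n K \<in> B - (V ^^ n) `` K" if "finite K" "K \<subseteq> ?S" for n K
    unfolding pick_def by (rule someI_ex[OF escape[OF that]])
  define K where "K = rec_nat {} (\<lambda>n K. insert (pick n K) K)"
  define x where "x n = pick n (K n)" for n
  define A where "A n = (V ^^ n) `` K n" for n
  have K_Suc: "K (Suc n) = insert (x n) (K n)" for n
    by (simp add: K_def x_def)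
  have K: "finite (K n) \<and> K n \<subseteq> ?S" for n
  proof (induction n)
    case 0
    show ?case by (simp add: K_def)
  next
    case (Suc n)
    then have "x n \<in> B"
      using pick by (auto simp: x_def)
    with Suc B(1) show ?case by (auto simp: K_Suc)
  qed
  have x: "x n \<in> B" "x n \<notin> A n" for n
    using pick K by (auto simp: x_def A_def)
  have A_sub: "A n \<subseteq> ?S" for n
    unfolding A_def using K[of n] V_sub by (cases n) (auto simp: relpow_Image_Suc)
  have A_step: "V `` A n \<subseteq> A (Suc n)" for n
    unfolding A_def relpow_Image_Suc[symmetric] by (intro Image_mono) (auto simp: K_Suc)
  have A_steps: "(V ^^ m) `` A n \<subseteq> A (n + m)" for m n
  proof (induction m)
    case (Suc m)
    have "(V ^^ Suc m) `` A n \<subseteq> V `` A (n + m)"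
      unfolding relpow_Image_Suc using Suc by blast
    with A_step show ?case by fastforce
  qed simp
  have "A n \<subseteq> A (Suc n)" for n
    using A_step[of n] A_sub[of n] V_refl by blast
  then have A_mono: "A m \<subseteq> A n" if "m \<le> n" for m n
    using that by (rule lift_Suc_mono_le)
  define C where "C = (\<Union>n. A n)"
  have "x n \<in> A (Suc n)" for n
  proof -
    have "(x n, x n) \<in> V"
      using x(1)[of n] B(1) V_refl by blast
    then have "(x n, x n) \<in> V ^^ m" for m
      by (induction m) auto
    then show ?thesis
      unfolding A_def K_Suc by blast
  qed
  then have x_C: "x n \<in> C" for n
    by (auto simp: C_def)

  have "\<exists>h :: 'a \<Rightarrow> real. continuous_map X (top_of_set {0..1}) h \<and> (\<forall>y\<in>A n. h y = 0) \<and>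
      (\<forall>y\<in>?S - A (Suc n). h y = 1)" for n
    using uniform_Urysohn[OF unif ind A_sub V(1) A_step] by metis
  then obtain h :: "nat \<Rightarrow> 'a \<Rightarrow> real" where
      h: "\<And>n. continuous_map X (top_of_set {0..1}) (h n)"
      and h0: "\<And>n y. y \<in> A n \<Longrightarrow> h n y = 0"
      and h1: "\<And>n y. y \<in> ?S - A (Suc n) \<Longrightarrow> h n y = 1"
    by metis
  have h01: "0 \<le> h n y" "h n y \<le> 1" if "y \<in> ?S" for n y
    using h[of n] that by (auto simp: continuous_map_in_subtopology)
  \<comment> \<open>The functions \<open>h j\<close> vanish on \<open>A n\<close> for \<open>j \<ge> n\<close>, so any layer that contains \<open>y\<close> gives an
    upper summation bound with the same value.\<close>
  define F where "F y = (if y \<in> C then \<Sum>j<(LEAST n. y \<in> A n). h j y else 0)" for y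
  have F_eq: "F y = (\<Sum>j<n. h j y)" if "y \<in> A n" for y n
  proof -
    define l where "l = (LEAST n. y \<in> A n)"
    have l: "y \<in> A l" "l \<le> n"
      unfolding l_def using that by (auto intro: LeastI Least_le)
    have "h j y = 0" if "l \<le> j" for j
      using h0 A_mono[OF that] l(1) by blast
    then have "(\<Sum>j<l. h j y) = (\<Sum>j<n. h j y)"
      using l(2) by (intro sum.mono_neutral_left) auto
    with \<open>y \<in> A n\<close> show ?thesis
      by (auto simp: F_def l_def C_def)
  qed
  show thesis
  proof
    \<comment> \<open>Continuity is glued from the complement of the union of the layers, where \<open>F\<close> vanishes, and
      the interiors of the layers, where \<open>F\<close> is a finite sum.\<close>
    define T where "T i = (case i of None \<Rightarrow> ?S - C | Some n \<Rightarrow> X interior_of A n)" for i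
    define g where "g i y = (case i of None \<Rightarrow> 0 | Some n \<Rightarrow> (\<Sum>j<n. h j y))" for i y
    have T_subset: "T (Some n) \<subseteq> A n" for n
      by (simp add: T_def interior_of_subset)
    have T_eq: "F y = g i y" if "y \<in> T i" for i y
    proof (cases i)
      case None
      with that show ?thesis by (simp add: T_def g_def F_def)
    next
      case (Some n)
      with that T_subset[of n] have "y \<in> A n" by blast
      with Some show ?thesis by (simp add: F_eq g_def)
    qed
    show "continuous_map X euclideanreal F"
    proof (rule pasting_lemma)
      show "openin X (T i)" for i
      proof (cases i)
        case None
        have "V `` {y} \<subseteq> ?S - C" if "y \<in> ?S - C" for y
        proof -
          have False if "(y, z) \<in> V" "z \<in> A n" for z n
            using that \<open>y \<in> ?S - C\<close> A_step[of n] symD[OF V(2)] by (auto simp: C_def)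
          then show ?thesis
            using V_sub by (auto simp: C_def)
        qed
        then have "openin X (?S - C)"
          using ind V(1) unfolding uniformity_induces_def by (meson Diff_subset)
        with None show ?thesis by (simp add: T_def)
      qed (simp add: T_def)
      show "continuous_map (subtopology X (T i)) euclideanreal (g i)" for i
      proof (cases i)
        case None
        then have "g i = (\<lambda>y. 0)"
          by (simp add: g_def fun_eq_iff)
        then show ?thesis by simp
      next
        case (Some n)
        then have "g i = (\<lambda>y. \<Sum>j<n. h j y)"
          by (simp add: g_def fun_eq_iff)
        moreover have "continuous_map X euclideanreal (h j)" for j
          using h[of j] by (simp add: continuous_map_in_subtopology)
        ultimately show ?thesis
          by (auto intro!: continuous_map_sum continuous_map_from_subtopology)
      qed
      show "g i y = g j y" if "y \<in> ?S \<inter> T i \<inter> T j" for i j y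
        using that T_eq by (metis IntD1 IntD2)
      show "\<exists>i. i \<in> UNIV \<and> y \<in> T i \<and> F y = g i y" if y: "y \<in> ?S" for y
      proof (cases "y \<in> C")
        case True
        then obtain n where "y \<in> A n" by (auto simp: C_def)
        then have "V `` {y} \<subseteq> A (Suc n)"
          using A_step by blast
        then have "y \<in> T (Some (Suc n))"
          using V(1) y by (auto simp: T_def interior_of_uniform[OF unif ind])
        with T_eq show ?thesis by blast
      next
        case False
        then have "y \<in> T None"
          using y by (simp add: T_def)
        with T_eq show ?thesis by blast
      qed
    qed
  next
    fix D assume "bourbaki_bounded ?S \<U> D"
    then obtain m L where L: "finite L" "L \<subseteq> ?S" "D \<subseteq> (V ^^ m) `` L" and D: "D \<subseteq> ?S"
      using V(1) unfolding bourbaki_bounded_def by meson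
    \<comment> \<open>Only the centres in the union of the layers matter: they lie in a common layer \<open>A M\<close>, and
      \<open>m\<close> further steps of \<open>V\<close> lead at most to \<open>A (M + m)\<close>.\<close>
    have "\<forall>k\<in>L \<inter> C. \<exists>n. k \<in> A n"
      by (auto simp: C_def)
    then obtain N where N: "\<And>k. k \<in> L \<inter> C \<Longrightarrow> k \<in> A (N k)"
      by metis
    define M where "M = Max (insert 0 (N ` (L \<inter> C)))"
    have LM: "L \<inter> C \<subseteq> A M"
    proof
      fix k assume k: "k \<in> L \<inter> C"
      then have "N k \<le> M"
        unfolding M_def using L(1) by (intro Max_ge) auto
      with N[OF k] A_mono show "k \<in> A M" by blast
    qed
    have "norm (F y) \<le> M + m" if y: "y \<in> D" for y
    proof (cases "y \<in> C")
      case True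
      then obtain n where n: "y \<in> A n" by (auto simp: C_def)
      obtain k where k: "k \<in> L" "(k, y) \<in> V ^^ m"
        using y L(3) by blast
      then have "(y, k) \<in> V ^^ m"
        using sym_relpow[OF V(2)] by (meson symD)
      then have "k \<in> C"
        using n A_steps[of m n] by (auto simp: C_def)
      then have "y \<in> A (M + m)"
        using k LM A_steps[of m M] by blast
      then have "F y = (\<Sum>j<M + m. h j y)"
        by (rule F_eq)
      also have "norm \<dots> \<le> (\<Sum>j<M + m. 1)"
        using h01 y D by (intro sum_norm_le) auto
      finally show ?thesis by simp
    qed (simp add: F_def)
    then show "bounded (F ` D)"
      unfolding bounded_iff by blast
  next
    have "n \<le> F (x n)" for n
    proof -
      obtain N where N: "x n \<in> A N"
        using x_C by (auto simp: C_def)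
      have "\<not> N \<le> n"
        using N x(2)[of n] A_mono by blast
      have "h j (x n) = 1" if "j < n" for j
      proof -
        have "x n \<notin> A (Suc j)"
          using x(2)[of n] A_mono[of "Suc j" n] that by auto
        then show ?thesis
          using x(1)[of n] B(1) by (intro h1) auto
      qed
      then have "real n = (\<Sum>j<n. h j (x n))"
        by simp
      also have "\<dots> \<le> (\<Sum>j<N. h j (x n))"
        using \<open>\<not> N \<le> n\<close> h01 x(1)[of n] B(1) by (intro sum_mono2) auto
      finally show ?thesis
        by (simp add: F_eq[OF N])
    qed
    show "\<not> bounded (F ` B)"
    proof
      assume "bounded (F ` B)"
      then obtain a where a: "\<And>y. y \<in> B \<Longrightarrow> \<bar>F y\<bar> \<le> a"
        by (auto simp: bounded_iff)
      obtain n where "a < real n"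
        using reals_Archimedean2 by blast
      with a[OF x(1)[of n]] \<open>real n \<le> F (x n)\<close> show False by simp
    qed
  qed
qed

section \<open>The initial uniformity of a family of real functions\<close>

definition coordinate_entourage :: "'a set \<Rightarrow> ('i \<Rightarrow> 'a \<Rightarrow> real) \<Rightarrow> 'i set \<Rightarrow> real \<Rightarrow> 'a rel" where
  "coordinate_entourage S \<phi> F e = {(x, y) \<in> S \<times> S. \<forall>i\<in>F. \<bar>\<phi> i y - \<phi> i x\<bar> < e}"

definition initial_uniformity :: "'a set \<Rightarrow> ('i \<Rightarrow> 'a \<Rightarrow> real) \<Rightarrow> 'i set \<Rightarrow> 'a rel set" where
  "initial_uniformity S \<phi> I =
     {U. U \<subseteq> S \<times> S \<and> (\<exists>F e. finite F \<and> F \<subseteq> I \<and> 0 < e \<and> coordinate_entourage S \<phi> F e \<subseteq> U)}"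

lemma initial_uniformityE:
  assumes "U \<in> initial_uniformity S \<phi> I"
  obtains F e where "finite F" "F \<subseteq> I" "0 < e" "coordinate_entourage S \<phi> F e \<subseteq> U"
  using assms by (auto simp: initial_uniformity_def)

lemma coordinate_entourage_in_initial_uniformity:
  assumes "finite F" "F \<subseteq> I" "0 < e"
  shows "coordinate_entourage S \<phi> F e \<in> initial_uniformity S \<phi> I"
  unfolding initial_uniformity_def using assms by (auto simp: coordinate_entourage_def)

lemma is_uniformity_initial_uniformity: "is_uniformity S (initial_uniformity S \<phi> I)"
  unfolding is_uniformity_def
proof (intro conjI ballI allI impI)
  let ?\<U> = "initial_uniformity S \<phi> I"
  show "S \<times> S \<in> ?\<U>"
    by (auto simp: initial_uniformity_def coordinate_entourage_def intro!: exI[of _ "{}"] exI[of _ 1])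
  fix U assume U: "U \<in> ?\<U>"
  then obtain F e where Fe: "finite F" "F \<subseteq> I" "0 < e" "coordinate_entourage S \<phi> F e \<subseteq> U"
    by (rule initial_uniformityE)
  show "U \<subseteq> S \<times> S"
    using U by (simp add: initial_uniformity_def)
  have "Id_on S \<subseteq> coordinate_entourage S \<phi> F e"
    using Fe(3) by (auto simp: coordinate_entourage_def)
  with Fe(4) show "Id_on S \<subseteq> U" by blast
  show "V \<in> ?\<U>" if "U \<subseteq> V \<and> V \<subseteq> S \<times> S" for V
    using that Fe unfolding initial_uniformity_def by blast
  show "U \<inter> V \<in> ?\<U>" if V: "V \<in> ?\<U>" for V
  proof -
    obtain F' e' where F'e': "finite F'" "F' \<subseteq> I" "0 < e'" "coordinate_entourage S \<phi> F' e' \<subseteq> V"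
      using V by (rule initial_uniformityE)
    have "coordinate_entourage S \<phi> (F \<union> F') (min e e') \<subseteq> U \<inter> V"
      using Fe(4) F'e'(4) unfolding coordinate_entourage_def by fastforce
    moreover have "finite (F \<union> F')" "F \<union> F' \<subseteq> I" "0 < min e e'"
      using Fe F'e' by auto
    ultimately show ?thesis
      using \<open>U \<subseteq> S \<times> S\<close> unfolding initial_uniformity_def by blast
  qed
  have "coordinate_entourage S \<phi> F e \<subseteq> U\<inverse>"
    using Fe(4) by (auto simp: coordinate_entourage_def abs_minus_commute)
  moreover have "U\<inverse> \<subseteq> S \<times> S"
    using \<open>U \<subseteq> S \<times> S\<close> by blast
  ultimately show "U\<inverse> \<in> ?\<U>"
    using Fe unfolding initial_uniformity_def by blast
  let ?V = "coordinate_entourage S \<phi> F (e / 2)"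
  have "?V O ?V \<subseteq> coordinate_entourage S \<phi> F e"
  proof clarify
    fix x y z assume xyz: "(x, y) \<in> ?V" "(y, z) \<in> ?V"
    have "\<bar>\<phi> i z - \<phi> i x\<bar> < e" if "i \<in> F" for i
    proof -
      have "\<bar>\<phi> i y - \<phi> i x\<bar> < e / 2" "\<bar>\<phi> i z - \<phi> i y\<bar> < e / 2"
        using xyz that by (auto simp: coordinate_entourage_def)
      then show ?thesis by linarith
    qed
    with xyz show "(x, z) \<in> coordinate_entourage S \<phi> F e"
      by (simp add: coordinate_entourage_def)
  qed
  moreover have "?V \<in> ?\<U>"
    using Fe by (intro coordinate_entourage_in_initial_uniformity) auto
  ultimately show "\<exists>V\<in>?\<U>. V O V \<subseteq> U"
    using Fe(4) by blast
qed

text \<open>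
  Chains of \<open>n\<close> steps of size 1 in one coordinate change it by at most \<open>n\<close>, so Bourbaki bounded sets
  are bounded in every coordinate.  In the other direction, rounding the finitely many coordinates
  of an entourage to multiples of its width splits the set into finitely many cells, and one
  representative per cell suffices, with a single step.
\<close>

lemma bourbaki_bounded_initial_uniformity:
  "bourbaki_bounded S (initial_uniformity S \<phi> I) B \<longleftrightarrow> B \<subseteq> S \<and> (\<forall>i\<in>I. bounded (\<phi> i ` B))"
proof (intro iffI conjI ballI)
  assume B: "bourbaki_bounded S (initial_uniformity S \<phi> I) B"
  then show "B \<subseteq> S"
    by (simp add: bourbaki_bounded_def)
  fix i assume "i \<in> I"
  let ?U = "coordinate_entourage S \<phi> {i} 1"
  have "?U \<in> initial_uniformity S \<phi> I"
    using \<open>i \<in> I\<close> by (intro coordinate_entourage_in_initial_uniformity) auto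
  then obtain n K where K: "finite K" "B \<subseteq> (?U ^^ n) `` K"
    using B unfolding bourbaki_bounded_def by meson
  have step: "\<bar>\<phi> i y - \<phi> i x\<bar> \<le> n" if "(x, y) \<in> ?U ^^ n" for x y n
    using that
  proof (induction n arbitrary: y)
    case (Suc n)
    then obtain z where "(x, z) \<in> ?U ^^ n" "(z, y) \<in> ?U" by auto
    then have "\<bar>\<phi> i z - \<phi> i x\<bar> \<le> n" "\<bar>\<phi> i y - \<phi> i z\<bar> < 1"
      using Suc.IH by (auto simp: coordinate_entourage_def)
    then show ?case by simp
  qed simp
  have "\<phi> i ` B \<subseteq> (\<Union>k\<in>K. cball (\<phi> i k) n)"
    using K(2) step by (fastforce simp: dist_real_def abs_minus_commute)
  moreover have "bounded (\<Union>k\<in>K. cball (\<phi> i k) n)"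
    using K(1) by blast
  ultimately show "bounded (\<phi> i ` B)"
    by (rule bounded_subset[rotated])
next
  assume B: "B \<subseteq> S \<and> (\<forall>i\<in>I. bounded (\<phi> i ` B))"
  show "bourbaki_bounded S (initial_uniformity S \<phi> I) B"
    unfolding bourbaki_bounded_def
  proof (intro conjI ballI)
    show "B \<subseteq> S" using B by blast
    fix U assume "U \<in> initial_uniformity S \<phi> I"
    then obtain F e where Fe: "finite F" "F \<subseteq> I" "0 < e" "coordinate_entourage S \<phi> F e \<subseteq> U"
      by (rule initial_uniformityE)
    define cell where "cell x = (\<lambda>i\<in>F. \<lfloor>\<phi> i x / e\<rfloor>)" for x
    have "finite ((\<lambda>x. \<lfloor>\<phi> i x / e\<rfloor>) ` B)" if "i \<in> F" for i
    proof -
      have "bounded (\<phi> i ` B)"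
        using B \<open>i \<in> F\<close> Fe(2) by blast
      then obtain a where a: "\<forall>x\<in>B. \<bar>\<phi> i x\<bar> \<le> a"
        by (auto simp: bounded_iff)
      have "(\<lambda>x. \<lfloor>\<phi> i x / e\<rfloor>) ` B \<subseteq> {\<lfloor>- a / e\<rfloor>..\<lfloor>a / e\<rfloor>}"
      proof clarify
        fix x assume "x \<in> B"
        then have "- a \<le> \<phi> i x" "\<phi> i x \<le> a"
          using bspec[OF a] by fastforce+
        then show "\<lfloor>\<phi> i x / e\<rfloor> \<in> {\<lfloor>- a / e\<rfloor>..\<lfloor>a / e\<rfloor>}"
          using Fe(3) by (simp only: atLeastAtMost_iff) (intro conjI floor_mono divide_right_mono; simp)
      qed
      then show ?thesis
        using finite_subset by blast
    qed
    then have "finite (\<Pi>\<^sub>E i\<in>F. (\<lambda>x. \<lfloor>\<phi> i x / e\<rfloor>) ` B)"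
      using Fe(1) by (intro finite_PiE)
    moreover have "cell ` B \<subseteq> (\<Pi>\<^sub>E i\<in>F. (\<lambda>x. \<lfloor>\<phi> i x / e\<rfloor>) ` B)"
      by (auto simp: cell_def)
    ultimately have "finite (cell ` B)"
      by (rule finite_subset[rotated])
    then obtain K where K: "K \<subseteq> B" "finite K" "cell ` B = cell ` K"
      using finite_subset_image[of "cell ` B" cell B] by blast
    have "B \<subseteq> U `` K"
    proof
      fix x assume x: "x \<in> B"
      then obtain k where k: "k \<in> K" "cell x = cell k"
        using K(3) by blast
      have "\<bar>\<phi> i x - \<phi> i k\<bar> < e" if "i \<in> F" for i
      proof -
        have "\<lfloor>\<phi> i x / e\<rfloor> = \<lfloor>\<phi> i k / e\<rfloor>"
          using fun_cong[OF k(2), of i] that by (simp add: cell_def)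
        then have "\<bar>\<phi> i x / e - \<phi> i k / e\<bar> < 1"
          by linarith
        then have "\<bar>(\<phi> i x - \<phi> i k) / e\<bar> < 1"
          by (simp add: diff_divide_distrib)
        then show ?thesis
          using Fe(3) by (simp add: field_simps)
      qed
      then have "(k, x) \<in> coordinate_entourage S \<phi> F e"
        using x k(1) K(1) B by (auto simp: coordinate_entourage_def)
      with Fe(4) k(1) show "x \<in> U `` K" by blast
    qed
    then have "B \<subseteq> (U ^^ 1) `` K" by simp
    with K(1,2) B show "\<exists>n K. finite K \<and> K \<subseteq> S \<and> B \<subseteq> (U ^^ n) `` K"
      by (meson subset_trans)
  qed
qed

section \<open>Subspaces of products of real lines\<close>

lemma topspace_real_lines: "topspace (real_lines I) = extensional I"
  by (simp add: real_lines_def PiE_def)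

lemma openin_coordinate_box:
  assumes "finite F" "\<And>i. i \<in> F \<Longrightarrow> continuous_map X euclideanreal (\<phi> i)"
  shows "openin X {y \<in> topspace X. \<forall>i\<in>F. \<bar>\<phi> i y - a i\<bar> < e}"
proof -
  have "openin X {y \<in> topspace X. \<phi> i y \<in> ball (a i) e}" if "i \<in> F" for i
    using openin_continuous_map_preimage[OF assms(2)[OF that], of "ball (a i) e"] by simp
  then have "openin X (topspace X \<inter> (\<Inter>i\<in>F. {y \<in> topspace X. \<phi> i y \<in> ball (a i) e}))"
    using assms(1) by (intro openin_Int_Inter) auto
  also have "topspace X \<inter> (\<Inter>i\<in>F. {y \<in> topspace X. \<phi> i y \<in> ball (a i) e}) =
      {y \<in> topspace X. \<forall>i\<in>F. \<bar>\<phi> i y - a i\<bar> < e}"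
    by (auto simp: dist_real_def abs_minus_commute)
  finally show ?thesis .
qed

lemma open_real_lines_contains_box:
  assumes "openin (real_lines I) T" "s \<in> T"
  obtains F e where "finite F" "F \<subseteq> I" "0 < e"
    "\<forall>t\<in>extensional I. (\<forall>i\<in>F. \<bar>t i - s i\<bar> < e) \<longrightarrow> t \<in> T"
proof -
  from product_topology_open_contains_basis[OF assms[unfolded real_lines_def]]
  obtain Q where Q: "s \<in> Pi\<^sub>E I Q" "\<And>i. open (Q i)" "finite {i. Q i \<noteq> UNIV}" "Pi\<^sub>E I Q \<subseteq> T"
    by auto
  define F where "F = I \<inter> {i. Q i \<noteq> UNIV}"
  have F: "finite F" "F \<subseteq> I"
    using Q(3) by (auto simp: F_def)
  have "\<exists>e>0. ball (s i) e \<subseteq> Q i" if "i \<in> F" for i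
    using Q(1,2) that F(2) by (meson PiE_mem open_contains_ball subsetD)
  then obtain r where r: "\<And>i. i \<in> F \<Longrightarrow> 0 < r i \<and> ball (s i) (r i) \<subseteq> Q i"
    by metis
  \<comment> \<open>The 1 keeps the minimum defined and positive when \<open>F\<close> is empty.\<close>
  define e where "e = Min (insert 1 (r ` F))"
  have "0 < e"
    using F(1) r by (simp add: e_def)
  show thesis
  proof (rule that[OF F \<open>0 < e\<close>], intro ballI impI)
    fix t assume t: "t \<in> extensional I" "\<forall>i\<in>F. \<bar>t i - s i\<bar> < e"
    have "t i \<in> Q i" if "i \<in> I" for i
    proof (cases "i \<in> F")
      case True
      then have "e \<le> r i"
        unfolding e_def using F(1) by (intro Min_le) auto
      then have "t i \<in> ball (s i) (r i)"
        using bspec[OF t(2) True] by (simp add: dist_real_def abs_minus_commute)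
      with r[OF True] show ?thesis by blast
    next
      case False
      with that show ?thesis by (simp add: F_def)
    qed
    with t(1) Q(4) show "t \<in> T"
      by (auto simp: PiE_def)
  qed
qed

lemma uniformity_induces_initial_uniformity:
  assumes hom: "homeomorphic_map X (subtopology (real_lines I) S) f"
  shows "uniformity_induces (initial_uniformity (topspace X) (\<lambda>i x. f x i) I) X"
    (is "uniformity_induces ?\<U> X")
  unfolding uniformity_induces_def
proof (intro allI iffI conjI)
  have f_cont: "continuous_map X (subtopology (real_lines I) S) f"
    using hom by (rule homeomorphic_imp_continuous_map)
  then have f_ext: "f x \<in> extensional I" if "x \<in> topspace X" for x
    using that by (auto simp: continuous_map_def topspace_real_lines)
  have coord: "continuous_map X euclideanreal (\<lambda>x. f x i)" if "i \<in> I" for i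
    using f_cont that
    by (auto simp: continuous_map_in_subtopology real_lines_def continuous_map_componentwise)
  fix W
  {
    assume W: "openin X W"
    then show sub: "W \<subseteq> topspace X" by (rule openin_subset)
    have "openin (subtopology (real_lines I) S) (f ` W)"
      using homeomorphic_map_openness[OF hom sub] W by simp
    then obtain T where T: "openin (real_lines I) T" "f ` W = T \<inter> S"
      unfolding openin_subtopology by blast
    show "\<forall>x\<in>W. \<exists>U\<in>?\<U>. U `` {x} \<subseteq> W"
    proof
      fix x assume x: "x \<in> W"
      then have "f x \<in> T" using T(2) by blast
      with T(1) obtain F e where Fe: "finite F" "F \<subseteq> I" "0 < e"
        and box: "\<forall>t\<in>extensional I. (\<forall>i\<in>F. \<bar>t i - f x i\<bar> < e) \<longrightarrow> t \<in> T"
        by (rule open_real_lines_contains_box)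
      let ?U = "coordinate_entourage (topspace X) (\<lambda>i x. f x i) F e"
      have "y \<in> W" if "(x, y) \<in> ?U" for y
      proof -
        have y: "y \<in> topspace X" "\<And>i. i \<in> F \<Longrightarrow> \<bar>f y i - f x i\<bar> < e"
          using that by (auto simp: coordinate_entourage_def)
        have "f y \<in> T \<inter> S"
          using box f_ext y f_cont by (auto simp: continuous_map_def)
        then obtain w where "w \<in> W" "f w = f y"
          using T(2) by (metis imageE)
        then show ?thesis
          using homeomorphic_imp_injective_map[OF hom] y(1) sub by (metis inj_onD subsetD)
      qed
      moreover have "?U \<in> ?\<U>"
        using Fe by (rule coordinate_entourage_in_initial_uniformity)
      ultimately show "\<exists>U\<in>?\<U>. U `` {x} \<subseteq> W" by blast
    qed
  }
  assume W: "W \<subseteq> topspace X \<and> (\<forall>x\<in>W. \<exists>U\<in>?\<U>. U `` {x} \<subseteq> W)"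
  have "\<exists>T. openin X T \<and> x \<in> T \<and> T \<subseteq> W" if x: "x \<in> W" for x
  proof -
    obtain U where U: "U \<in> ?\<U>" "U `` {x} \<subseteq> W"
      using W x by blast
    from U(1) obtain F e where Fe: "finite F" "F \<subseteq> I" "0 < e"
        "coordinate_entourage (topspace X) (\<lambda>i x. f x i) F e \<subseteq> U"
      by (rule initial_uniformityE)
    let ?T = "{y \<in> topspace X. \<forall>i\<in>F. \<bar>f y i - f x i\<bar> < e}"
    have "openin X ?T"
      using Fe coord by (intro openin_coordinate_box) auto
    moreover have "x \<in> ?T"
      using x W Fe(3) by auto
    moreover have "?T \<subseteq> W"
    proof
      fix y assume "y \<in> ?T"
      then have "(x, y) \<in> coordinate_entourage (topspace X) (\<lambda>i x. f x i) F e"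
        using x W by (auto simp: coordinate_entourage_def)
      with Fe(4) U(2) show "y \<in> W" by blast
    qed
    ultimately show ?thesis by blast
  qed
  then show "openin X W"
    by (subst openin_subopen) blast
qed

section \<open>Isomorphisms with closed subspaces\<close>

lemma bornological_isomorphism_iff_homeomorphic_map:
  "bornological_isomorphism X \<B> Y \<C> f \<longleftrightarrow>
     homeomorphic_map X Y f \<and> (\<forall>B\<in>\<B>. f ` B \<in> \<C>) \<and> (\<forall>C\<in>\<C>. inv_into (topspace X) f ` C \<in> \<B>)"
proof -
  let ?g = "inv_into (topspace X) f"
  have "homeomorphic_map X Y f \<longleftrightarrow>
      bij_betw f (topspace X) (topspace Y) \<and> continuous_map X Y f \<and> continuous_map Y X ?g"
  proof (intro iffI conjI; (elim conjE)?)
    assume hom: "homeomorphic_map X Y f"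
    show bij: "bij_betw f (topspace X) (topspace Y)"
      using homeomorphic_imp_injective_map[OF hom] homeomorphic_imp_surjective_map[OF hom]
      by (simp add: bij_betw_def)
    show "continuous_map X Y f"
      using hom by (rule homeomorphic_imp_continuous_map)
    obtain g where g: "homeomorphic_maps X Y f g"
      using hom homeomorphic_map_maps by blast
    have "g y = ?g y" if "y \<in> topspace Y" for y
    proof -
      have "f (g y) = y" "g y \<in> topspace X"
        using g that by (auto simp: homeomorphic_maps_def continuous_map_def)
      then show ?thesis
        using bij by (metis bij_betw_def inv_into_f_f)
    qed
    then show "continuous_map Y X ?g"
      using g continuous_map_eq unfolding homeomorphic_maps_def by metis
  next
    assume "bij_betw f (topspace X) (topspace Y)" "continuous_map X Y f" "continuous_map Y X ?g"
    then have "homeomorphic_maps X Y f ?g"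
      unfolding homeomorphic_maps_def
      by (auto simp: bij_betw_inv_into_left bij_betw_inv_into_right)
    then show "homeomorphic_map X Y f"
      using homeomorphic_map_maps by blast
  qed
  then show ?thesis
    by (auto simp: bornological_isomorphism_def bornological_morphism_def)
qed

lemma real_lines_bornology_iff:
  "C \<in> subspace_bornology (real_lines_bornology I) S \<longleftrightarrow>
     C \<subseteq> topspace (subtopology (real_lines I) S) \<and> (\<forall>i\<in>I. bounded ((\<lambda>t. t i) ` C))"
  unfolding subspace_bornology_def real_lines_bornology_def product_bornology_def
    real_line_bornology_def real_lines_def by auto

text \<open>
  The bornological part of an isomorphism only says which sets are bounded in \<open>X\<close>, so the
  isomorphism reduces to a homeomorphism whose coordinates detect the bounded sets.
\<close>

lemma iso_closed_subspace_of_real_lines_iff: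
  assumes "bornological_universe X \<B>"
  shows "iso_closed_subspace_of_real_lines I X \<B> \<longleftrightarrow>
    (\<exists>S f. closedin (real_lines I) S \<and> homeomorphic_map X (subtopology (real_lines I) S) f \<and>
       \<B> = {B. B \<subseteq> topspace X \<and> (\<forall>i\<in>I. bounded ((\<lambda>x. f x i) ` B))})"
proof -
  have \<B>_sub: "B \<subseteq> topspace X" if "B \<in> \<B>" for B
    using assms that by (auto simp: bornological_universe_def bornology_on_def)
  have *: "(\<forall>B\<in>\<B>. f ` B \<in> \<C>) \<and> (\<forall>C\<in>\<C>. inv_into (topspace X) f ` C \<in> \<B>) \<longleftrightarrow>
      \<B> = {B. B \<subseteq> topspace X \<and> (\<forall>i\<in>I. bounded ((\<lambda>x. f x i) ` B))}" (is "?l \<longleftrightarrow> \<B> = ?D")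
    if hom: "homeomorphic_map X (subtopology (real_lines I) S) f"
      and C_def: "\<C> = subspace_bornology (real_lines_bornology I) S" for S f \<C>
  proof -
    let ?g = "inv_into (topspace X) f"
    have im: "f ` topspace X = topspace (subtopology (real_lines I) S)"
      and inj: "inj_on f (topspace X)"
      using homeomorphic_imp_surjective_map[OF hom] homeomorphic_imp_injective_map[OF hom] by auto
    have image_iff: "f ` B \<in> \<C> \<longleftrightarrow> B \<in> ?D" if "B \<subseteq> topspace X" for B
    proof -
      have "f ` B \<subseteq> topspace (subtopology (real_lines I) S)"
        using that im by blast
      with that show ?thesis
        unfolding C_def real_lines_bornology_iff by (simp add: image_image)
    qed
    have gf: "?g ` f ` B = B" if "B \<subseteq> topspace X" for B
      using inj that by (rule inv_into_image_cancel)
    have fg: "f ` ?g ` C = C" and gC: "?g ` C \<subseteq> topspace X" if "C \<in> \<C>" for C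
    proof -
      have "C \<subseteq> f ` topspace X"
        using that unfolding C_def real_lines_bornology_iff im by blast
      then show "f ` ?g ` C = C"
        by (rule image_inv_into_cancel[OF refl])
      show "?g ` C \<subseteq> topspace X"
        using \<open>C \<subseteq> f ` topspace X\<close> by (blast intro: inv_into_into)
    qed
    show ?thesis
    proof
      assume l: ?l
      show "\<B> = ?D"
      proof (intro equalityI subsetI)
        show "B \<in> ?D" if "B \<in> \<B>" for B
          using l that image_iff[OF \<B>_sub[OF that]] by blast
        show "B \<in> \<B>" if "B \<in> ?D" for B
        proof -
          have "B \<subseteq> topspace X" using that by blast
          then have "f ` B \<in> \<C>"
            using image_iff that by blast
          with l have "?g ` f ` B \<in> \<B>" by blast
          then show ?thesis
            by (simp only: gf[OF \<open>B \<subseteq> topspace X\<close>])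
        qed
      qed
    next
      assume D: "\<B> = ?D"
      show ?l
      proof (intro conjI ballI)
        show "f ` B \<in> \<C>" if "B \<in> \<B>" for B
          using image_iff[OF \<B>_sub[OF that]] that D by blast
        show "?g ` C \<in> \<B>" if "C \<in> \<C>" for C
          using image_iff[OF gC[OF that]] fg[OF that] that D by simp
      qed
    qed
  qed
  have "bornological_isomorphism X \<B> (subtopology (real_lines I) S)
        (subspace_bornology (real_lines_bornology I) S) =
      (\<lambda>f. homeomorphic_map X (subtopology (real_lines I) S) f \<and>
        \<B> = {B. B \<subseteq> topspace X \<and> (\<forall>i\<in>I. bounded ((\<lambda>x. f x i) ` B))})" for S
    unfolding fun_eq_iff bornological_isomorphism_iff_homeomorphic_map
    using *[OF _ refl] by (intro allI conj_cong[OF refl])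
  then show ?thesis
    unfolding iso_closed_subspace_of_real_lines_def bornologically_isomorphic_def by simp
qed

section \<open>Realcompactness of closed subspaces of products of real lines\<close>

lemma stone_cech_emb_in_stone_cech:
  assumes "x \<in> topspace X"
  shows "stone_cech_emb X x \<in> topspace (stone_cech X)"
proof -
  have "stone_cech_emb X ` topspace X \<subseteq> topspace (stone_cech X)"
    using closure_of_subset[OF stone_cech_emb_in_cube[of X]] stone_cech_emb_in_cube[of X]
    by (simp add: stone_cech_def)
  with assms show ?thesis by blast
qed

lemma continuous_map_stone_cech_emb: "continuous_map X (stone_cech X) (stone_cech_emb X)"
proof -
  have "continuous_map X (unit_cube X) (stone_cech_emb X)"
    unfolding unit_cube_def continuous_map_componentwise
    by (auto simp: stone_cech_emb_def unit_maps_def)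
  then show ?thesis
    using stone_cech_emb_in_stone_cech unfolding stone_cech_def continuous_map_in_subtopology
    by fastforce
qed

lemma continuous_map_stone_cech_ext:
  assumes "continuous_map X euclideanreal f"
  shows "continuous_map (stone_cech X) (Alexandroff_compactification euclideanreal) (stone_cech_ext X f)"
  using theI'[OF stone_cech_ext_ex1[OF assms]] unfolding stone_cech_ext_def by blast

lemma stone_cech_ext_emb:
  assumes "continuous_map X euclideanreal f" "x \<in> topspace X"
  shows "stone_cech_ext X f (stone_cech_emb X x) = Some (f x)"
  using theI'[OF stone_cech_ext_ex1[OF assms(1)]] assms(2) unfolding stone_cech_ext_def by blast

lemma stone_cech_emb_in_upsilon:
  assumes "x \<in> topspace X"
  shows "stone_cech_emb X x \<in> upsilon X \<B>"
  using assms
  by (auto simp: upsilon_def bounded_continuous_maps_def stone_cech_emb_in_stone_cech stone_cech_ext_emb)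

text \<open>
  For a point \<open>p\<close> of \<open>\<beta>(X)\<close> with finite values \<open>s\<^sub>i\<close> of the extended coordinates, density of \<open>X\<close> yields
  points \<open>x\<close> of \<open>X\<close> that are simultaneously close to \<open>p\<close> in \<open>\<beta>(X)\<close> and, in the product of lines,
  close to \<open>s\<close>.  Closedness turns \<open>s\<close> into the image of a point of \<open>X\<close>; simultaneous closeness and
  the homeomorphism onto the subspace exclude that this point differs from \<open>p\<close>.
\<close>

lemma closed_subspace_imp_realcompact:
  assumes clo: "closedin (real_lines I) S"
    and hom: "homeomorphic_map X (subtopology (real_lines I) S) f"
    and coord_bounded: "\<And>i B. \<lbrakk>i \<in> I; B \<in> \<B>\<rbrakk> \<Longrightarrow> bounded ((\<lambda>x. f x i) ` B)"
  shows "bornologically_realcompact X \<B>"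
  unfolding bornologically_realcompact_def
proof
  show "stone_cech_emb X ` topspace X \<subseteq> upsilon X \<B>"
    by (rule image_subsetI) (rule stone_cech_emb_in_upsilon)
  have f_cont: "continuous_map X (subtopology (real_lines I) S) f"
    using hom by (rule homeomorphic_imp_continuous_map)
  then have f_in: "f x \<in> extensional I" "f x \<in> S" if "x \<in> topspace X" for x
    using that by (auto simp: continuous_map_def topspace_real_lines)
  define \<phi> where "\<phi> i x = f x i" for i x
  have \<phi>: "continuous_map X euclideanreal (\<phi> i)" if "i \<in> I" for i
    using f_cont that unfolding \<phi>_def
    by (auto simp: continuous_map_in_subtopology real_lines_def continuous_map_componentwise)
  show "upsilon X \<B> \<subseteq> stone_cech_emb X ` topspace X"
  proof
    fix p assume p: "p \<in> upsilon X \<B>"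
    then have p\<beta>: "p \<in> topspace (stone_cech X)"
      by (simp add: upsilon_def)
    define s where "s = (\<lambda>i\<in>I. the (stone_cech_ext X (\<phi> i) p))"
    have s: "stone_cech_ext X (\<phi> i) p = Some (s i)" if "i \<in> I" for i
    proof -
      have "\<phi> i \<in> bounded_continuous_maps X \<B>"
        using \<phi>[OF that] coord_bounded[OF that] by (simp add: bounded_continuous_maps_def \<phi>_def)
      then show ?thesis
        using p that by (auto simp: upsilon_def s_def)
    qed
    have near: "\<exists>x\<in>topspace X. stone_cech_emb X x \<in> U \<and> f x \<in> T"
      if U: "openin (stone_cech X) U" "p \<in> U" and T: "openin (real_lines I) T" "s \<in> T" for U T
    proof -
      obtain F e where Fe: "finite F" "F \<subseteq> I" "0 < e"
        and box: "\<forall>t\<in>extensional I. (\<forall>i\<in>F. \<bar>t i - s i\<bar> < e) \<longrightarrow> t \<in> T"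
        using T by (rule open_real_lines_contains_box)
      define N where "N i = {q \<in> topspace (stone_cech X). stone_cech_ext X (\<phi> i) q \<in> Some ` ball (s i) e}" for i
      have "openin (stone_cech X) (N i)" if "i \<in> F" for i
        unfolding N_def
      proof (rule openin_continuous_map_preimage)
        show "continuous_map (stone_cech X) (Alexandroff_compactification euclideanreal) (stone_cech_ext X (\<phi> i))"
          using that Fe(2) by (intro continuous_map_stone_cech_ext \<phi>) blast
        show "openin (Alexandroff_compactification euclideanreal) (Some ` ball (s i) e)"
          unfolding openin_Alexandroff_compactification by auto
      qed
      then have "openin (stone_cech X) (U \<inter> (\<Inter>i\<in>F. N i))"
        using U(1) Fe(1) by (intro openin_Int_Inter) auto
      moreover have "p \<in> U \<inter> (\<Inter>i\<in>F. N i)"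
        using U(2) p\<beta> s Fe by (auto simp: N_def)
      moreover have "p \<in> stone_cech X closure_of (stone_cech_emb X ` topspace X)"
        using p\<beta> by (simp add: stone_cech_dense)
      ultimately obtain x where x: "x \<in> topspace X" "stone_cech_emb X x \<in> U \<inter> (\<Inter>i\<in>F. N i)"
        unfolding in_closure_of by blast
      have "\<bar>f x i - s i\<bar> < e" if "i \<in> F" for i
      proof -
        have "stone_cech_ext X (\<phi> i) (stone_cech_emb X x) \<in> Some ` ball (s i) e"
          using x(2) that by (auto simp: N_def)
        moreover have "stone_cech_ext X (\<phi> i) (stone_cech_emb X x) = Some (f x i)"
          using stone_cech_ext_emb[OF \<phi> x(1)] that Fe(2) by (auto simp: \<phi>_def)
        ultimately show ?thesis
          by (auto simp: dist_real_def abs_minus_commute)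
      qed
      with box f_in[OF x(1)] have "f x \<in> T" by blast
      with x show ?thesis by blast
    qed
    have "s \<in> real_lines I closure_of S"
      unfolding in_closure_of
    proof (intro conjI allI impI)
      show "s \<in> topspace (real_lines I)"
        by (simp add: topspace_real_lines s_def)
      fix T assume "s \<in> T \<and> openin (real_lines I) T"
      then obtain x where "x \<in> topspace X" "f x \<in> T"
        using near[OF openin_topspace p\<beta>] by blast
      with f_in show "\<exists>y. y \<in> S \<and> y \<in> T" by blast
    qed
    then have "s \<in> topspace (subtopology (real_lines I) S)"
      using clo by (simp add: closure_of_closedin closedin_def Int_absorb1 subset_iff)
    then obtain x where x: "x \<in> topspace X" "f x = s"
      using homeomorphic_imp_surjective_map[OF hom] by (metis imageE)
    have "p = stone_cech_emb X x"
    proof (rule ccontr)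
      assume "p \<noteq> stone_cech_emb X x"
      then obtain U V where UV: "openin (stone_cech X) U" "p \<in> U"
          "openin (stone_cech X) V" "stone_cech_emb X x \<in> V" "disjnt U V"
        using compact_Hausdorff_stone_cech(2) p\<beta> stone_cech_emb_in_stone_cech[OF x(1)]
        unfolding Hausdorff_space_def by meson
      define W where "W = {y \<in> topspace X. stone_cech_emb X y \<in> V}"
      have W: "openin X W" "W \<subseteq> topspace X" "x \<in> W"
        using openin_continuous_map_preimage[OF continuous_map_stone_cech_emb UV(3)] UV(4) x(1)
        by (auto simp: W_def)
      have "openin (subtopology (real_lines I) S) (f ` W)"
        using homeomorphic_map_openness[OF hom W(2)] W(1) by simp
      then obtain T where T: "openin (real_lines I) T" "f ` W = T \<inter> S"
        unfolding openin_subtopology by blast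
      have "s \<in> T"
        using x(2) W(3) T(2) by blast
      then obtain y where y: "y \<in> topspace X" "stone_cech_emb X y \<in> U" "f y \<in> T"
        using near[OF UV(1,2) T(1)] by blast
      then have "f y \<in> f ` W"
        using T(2) f_in by blast
      then have "y \<in> W"
        using homeomorphic_imp_injective_map[OF hom] W(2) y(1) by (simp add: inj_on_image_mem_iff)
      then show False
        using y(2) UV(5) by (auto simp: W_def disjnt_def)
    qed
    with x(1) show "p \<in> stone_cech_emb X ` topspace X" by blast
  qed
qed

section \<open>The embedding by the functions that are bounded on bounded sets\<close>

definition real_evaluation :: "'a topology \<Rightarrow> 'a set set \<Rightarrow> 'a \<Rightarrow> ('a \<Rightarrow> real) \<Rightarrow> real" where
  "real_evaluation X \<B> x = (\<lambda>f\<in>bounded_continuous_maps X \<B>. f x)"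

lemma continuous_map_real_evaluation:
  "continuous_map X (real_lines (bounded_continuous_maps X \<B>)) (real_evaluation X \<B>)"
  unfolding real_lines_def continuous_map_componentwise
  by (auto simp: real_evaluation_def bounded_continuous_maps_def)

lemma unit_interval_map_in_bounded_continuous_maps:
  assumes "bornological_universe X \<B>" "continuous_map X (top_of_set {0..1}) f"
  shows "f \<in> bounded_continuous_maps X \<B>"
proof -
  have "bounded (f ` B)" if "B \<in> \<B>" for B
  proof (rule bounded_subset[OF bounded_closed_interval])
    show "f ` B \<subseteq> {0..1}"
      using that assms
      by (auto simp: bornological_universe_def bornology_on_def continuous_map_in_subtopology)
  qed
  then show ?thesis
    using assms(2) by (simp add: bounded_continuous_maps_def continuous_map_in_subtopology)
qed

text \<open>
  Bounded functions are bounded on all members of the bornology, so complete regularity provides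
  enough functions to separate points from closed sets, whatever the bornology is.
\<close>

lemma homeomorphic_map_real_evaluation:
  assumes born: "bornological_universe X \<B>"
    and creg: "completely_regular_space X" and "Hausdorff_space X"
  defines "I \<equiv> bounded_continuous_maps X \<B>" and "S \<equiv> real_evaluation X \<B> ` topspace X"
  shows "homeomorphic_map X (subtopology (real_lines I) S) (real_evaluation X \<B>)"
proof (rule bijective_open_imp_homeomorphic_map)
  let ?e = "real_evaluation X \<B>"
  have separate: "\<exists>h\<in>I. h x = 0 \<and> h ` C \<subseteq> {1}" if "closedin X C" "x \<in> topspace X - C" for x C
  proof -
    obtain h :: "'a \<Rightarrow> real" where "continuous_map X (top_of_set {0..1}) h" "h x = 0" "h ` C \<subseteq> {1}"
      using creg \<open>closedin X C\<close> \<open>x \<in> topspace X - C\<close> unfolding completely_regular_space_def by blast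
    then show ?thesis
      using unit_interval_map_in_bounded_continuous_maps[OF born] unfolding I_def by blast
  qed
  show "continuous_map X (subtopology (real_lines I) S) ?e"
    using continuous_map_real_evaluation by (auto simp: continuous_map_in_subtopology I_def S_def)
  have "S \<subseteq> topspace (real_lines I)"
    by (auto simp: S_def I_def topspace_real_lines real_evaluation_def)
  then show "?e ` topspace X = topspace (subtopology (real_lines I) S)"
    by (auto simp: S_def)
  show "inj_on ?e (topspace X)"
  proof (rule inj_onI, rule ccontr)
    fix x y assume xy: "x \<in> topspace X" "y \<in> topspace X" "?e x = ?e y" "x \<noteq> y"
    have "closedin X {y}"
      using \<open>Hausdorff_space X\<close> xy(2) by (rule closedin_Hausdorff_singleton)
    then obtain h where h: "h \<in> I" "h x = 0" "h ` {y} \<subseteq> {1}"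
      using separate[of "{y}" x] xy by blast
    have "h x = h y"
      using fun_cong[OF xy(3), of h] h(1) by (simp add: real_evaluation_def I_def)
    with h show False by simp
  qed
  show "open_map X (subtopology (real_lines I) S) ?e"
    unfolding open_map_def
  proof (intro allI impI)
    fix W assume W: "openin X W"
    have "\<exists>T. openin (subtopology (real_lines I) S) T \<and> t \<in> T \<and> T \<subseteq> ?e ` W" if t: "t \<in> ?e ` W" for t
    proof -
      obtain x where x: "x \<in> W" "t = ?e x"
        using t by blast
      have "closedin X (topspace X - W)" "x \<in> topspace X - (topspace X - W)"
        using W x(1) openin_subset by auto
      then obtain h where h: "h \<in> I" "h x = 0" "h ` (topspace X - W) \<subseteq> {1}"
        using separate by blast
      define N where "N = {u \<in> topspace (real_lines I). u h \<in> {..<1}}"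
      have "continuous_map (real_lines I) euclideanreal (\<lambda>u. u h)"
        unfolding real_lines_def using h(1) by (rule continuous_map_product_coordinates)
      then have "openin (real_lines I) N"
        unfolding N_def by (rule openin_continuous_map_preimage) simp
      moreover have "t \<in> N \<inter> S"
        using x W openin_subset[OF W] h(1,2)
        by (auto simp: N_def S_def topspace_real_lines real_evaluation_def I_def)
      moreover have "N \<inter> S \<subseteq> ?e ` W"
      proof
        fix u assume u: "u \<in> N \<inter> S"
        then obtain y where y: "y \<in> topspace X" "u = ?e y"
          by (auto simp: S_def)
        have "h y < 1"
          using u y(2) h(1) by (simp add: N_def real_evaluation_def I_def)
        then have "y \<in> W"
          using h(3) y(1) by force
        with y(2) show "u \<in> ?e ` W" by blast
      qed
      ultimately show ?thesis
        unfolding openin_subtopology by (intro exI[of _ "N \<inter> S"]) blast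
    qed
    then show "openin (subtopology (real_lines I) S) (?e ` W)"
      by (subst openin_subopen) blast
  qed
qed

text \<open>
  The extensions \<open>f\<^sup>\<beta>\<close> form a map \<open>E\<close> from \<open>\<beta>(X)\<close> to the product of one-point compactifications of the
  line.  Its image is compact, hence closed, and it contains the image of \<open>X\<close>, so that every limit
  \<open>s\<close> of that image has the form \<open>E p\<close>.  All coordinates of \<open>s\<close> are finite, which is
  the condition for \<open>p\<close> to lie in \<open>\<upsilon>\<^sub>\<B>(X)\<close>.
\<close>

lemma realcompact_imp_closedin_real_evaluation:
  assumes realcompact: "bornologically_realcompact X \<B>"
  defines "I \<equiv> bounded_continuous_maps X \<B>"
  shows "closedin (real_lines I) (real_evaluation X \<B> ` topspace X)"
proof -
  let ?e = "real_evaluation X \<B>" and ?A = "Alexandroff_compactification euclideanreal"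
  let ?S = "?e ` topspace X" and ?P = "product_topology (\<lambda>f. ?A) I"
  have I_cont: "continuous_map X euclideanreal f" if "f \<in> I" for f
    using that by (simp add: I_def bounded_continuous_maps_def)
  define E where "E q = (\<lambda>f\<in>I. stone_cech_ext X f q)" for q
  define J where "J t = (\<lambda>f\<in>I. Some (t f))" for t :: "('a \<Rightarrow> real) \<Rightarrow> real"
  have "Hausdorff_space ?A"
    by (auto simp: Hausdorff_space_Alexandroff_compactification locally_compact_space_euclidean)
  then have "Hausdorff_space ?P"
    by (simp add: Hausdorff_space_product_topology)
  moreover have "continuous_map (stone_cech X) ?P E"
    unfolding continuous_map_componentwise
    using continuous_map_stone_cech_ext[OF I_cont] by (auto simp: E_def)
  then have "compactin ?P (E ` topspace (stone_cech X))"
    using compact_Hausdorff_stone_cech(1) unfolding compact_space_def by (intro image_compactin)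
  ultimately have E_closed: "closedin ?P (E ` topspace (stone_cech X))"
    by (rule compactin_imp_closedin)
  have "continuous_map (real_lines I) ?A (\<lambda>t. Some (t f))" if "f \<in> I" for f
    using continuous_map_compose[OF continuous_map_product_coordinates[OF that] continuous_map_Some]
    by (simp add: real_lines_def o_def)
  then have J: "continuous_map (real_lines I) ?P J"
    unfolding continuous_map_componentwise by (auto simp: J_def)
  have JE: "J (?e x) = E (stone_cech_emb X x)" if "x \<in> topspace X" for x
    using that stone_cech_ext_emb[OF I_cont]
    by (auto simp: J_def E_def real_evaluation_def I_def fun_eq_iff)
  have "real_lines I closure_of ?S \<subseteq> ?S"
  proof
    fix s assume s: "s \<in> real_lines I closure_of ?S"
    have "J s \<in> ?P closure_of (J ` ?S)"
      using continuous_map_image_closure_subset[OF J] s by blast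
    moreover have "J ` ?S \<subseteq> E ` topspace (stone_cech X)"
      using JE stone_cech_emb_in_stone_cech by fastforce
    ultimately have "J s \<in> E ` topspace (stone_cech X)"
      using closure_of_minimal[OF _ E_closed] by blast
    then obtain p where p: "p \<in> topspace (stone_cech X)" "J s = E p"
      by blast
    have ext: "stone_cech_ext X f p = Some (s f)" if "f \<in> I" for f
      using fun_cong[OF p(2), of f] that by (simp add: J_def E_def)
    then have "p \<in> upsilon X \<B>"
      using p(1) by (simp add: upsilon_def I_def)
    then obtain x where x: "x \<in> topspace X" "p = stone_cech_emb X x"
      using realcompact unfolding bornologically_realcompact_def by blast
    have "s f = ?e x f" if "f \<in> I" for f
      using ext[OF that] stone_cech_ext_emb[OF I_cont[OF that] x(1)] x(2) that
      by (simp add: real_evaluation_def I_def)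
    moreover have "s \<in> extensional I" "?e x \<in> extensional I"
      using s by (auto simp: in_closure_of topspace_real_lines real_evaluation_def I_def)
    ultimately have "s = ?e x"
      by (intro extensionalityI[of s I]) auto
    with x(1) show "s \<in> ?S" by blast
  qed
  moreover have "?S \<subseteq> topspace (real_lines I)"
    by (auto simp: topspace_real_lines real_evaluation_def I_def)
  ultimately show ?thesis
    using closure_of_subset_eq by blast
qed

lemma Hausdorff_uniformizable_realcompact_imp_iso:
  assumes born: "bornological_universe X \<B>"
    and "Hausdorff_uniformizable X \<B>" "bornologically_realcompact X \<B>"
  shows "iso_closed_subspace_of_real_lines (bounded_continuous_maps X \<B>) X \<B>"
proof -
  obtain \<U> where \<U>: "is_uniformity (topspace X) \<U>" "uniformity_induces \<U> X"
      and \<B>: "\<B> = {B. bourbaki_bounded (topspace X) \<U> B}" and "Hausdorff_space X"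
    using assms(2) unfolding Hausdorff_uniformizable_def uniformizable_def by blast
  let ?I = "bounded_continuous_maps X \<B>" and ?e = "real_evaluation X \<B>"
  have bounded_iff: "B \<in> \<B> \<longleftrightarrow> B \<subseteq> topspace X \<and> (\<forall>f\<in>?I. bounded ((\<lambda>x. ?e x f) ` B))" for B
  proof
    assume "B \<in> \<B>"
    then show "B \<subseteq> topspace X \<and> (\<forall>f\<in>?I. bounded ((\<lambda>x. ?e x f) ` B))"
      using born
      by (auto simp: bornological_universe_def bornology_on_def real_evaluation_def
          bounded_continuous_maps_def)
  next
    assume B: "B \<subseteq> topspace X \<and> (\<forall>f\<in>?I. bounded ((\<lambda>x. ?e x f) ` B))"
    show "B \<in> \<B>"
    proof (rule ccontr)
      assume "B \<notin> \<B>"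
      then have "\<not> bourbaki_bounded (topspace X) \<U> B"
        by (simp add: \<B>)
      with B obtain F :: "'a \<Rightarrow> real" where F: "continuous_map X euclideanreal F"
        "\<And>D. bourbaki_bounded (topspace X) \<U> D \<Longrightarrow> bounded (F ` D)" "\<not> bounded (F ` B)"
        using unbounded_function_on_unbounded_set[OF \<U>] by metis
      then have "F \<in> ?I"
        by (simp add: bounded_continuous_maps_def \<B>)
      with B F(3) show False
        by (simp add: real_evaluation_def)
    qed
  qed
  show ?thesis
    unfolding iso_closed_subspace_of_real_lines_iff[OF born]
  proof (intro exI conjI)
    show "closedin (real_lines ?I) (?e ` topspace X)"
      using assms(3) by (rule realcompact_imp_closedin_real_evaluation)
    show "homeomorphic_map X (subtopology (real_lines ?I) (?e ` topspace X)) ?e"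
      using born uniform_imp_completely_regular_space[OF \<U>] \<open>Hausdorff_space X\<close>
      by (rule homeomorphic_map_real_evaluation)
    show "\<B> = {B. B \<subseteq> topspace X \<and> (\<forall>f\<in>?I. bounded ((\<lambda>x. ?e x f) ` B))}"
      using bounded_iff by blast
  qed
qed

lemma iso_imp_Hausdorff_uniformizable_realcompact:
  assumes born: "bornological_universe X \<B>" and "iso_closed_subspace_of_real_lines I X \<B>"
  shows "Hausdorff_uniformizable X \<B> \<and> bornologically_realcompact X \<B>"
proof -
  obtain S f where S: "closedin (real_lines I) S"
    and f: "homeomorphic_map X (subtopology (real_lines I) S) f"
    and \<B>: "\<B> = {B. B \<subseteq> topspace X \<and> (\<forall>i\<in>I. bounded ((\<lambda>x. f x i) ` B))}"
    using assms(2) unfolding iso_closed_subspace_of_real_lines_iff[OF born] by blast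
  have "\<B> = {B. bourbaki_bounded (topspace X) (initial_uniformity (topspace X) (\<lambda>i x. f x i) I) B}"
    unfolding bourbaki_bounded_initial_uniformity by (rule \<B>)
  then have "uniformizable X \<B>"
    unfolding uniformizable_def
    using is_uniformity_initial_uniformity uniformity_induces_initial_uniformity[OF f] by blast
  moreover have "Hausdorff_space (subtopology (real_lines I) S)"
    unfolding real_lines_def
    by (intro Hausdorff_space_subtopology) (simp add: Hausdorff_space_product_topology)
  then have "Hausdorff_space X"
    using f homeomorphic_Hausdorff_space homeomorphic_space by blast
  moreover have "bornologically_realcompact X \<B>"
    using S f by (rule closed_subspace_imp_realcompact) (use \<B> in blast)
  ultimately show ?thesis
    by (simp add: Hausdorff_uniformizable_def)
qed

theorem proposition22:
  fixes X :: "'a topology" and \<B> :: "'a set set"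
  assumes "bornological_universe X \<B>"
  shows "(Hausdorff_uniformizable X \<B> \<and> bornologically_realcompact X \<B> \<longleftrightarrow>
            (\<exists>I :: ('a \<Rightarrow> real) set. iso_closed_subspace_of_real_lines I X \<B>)) \<and>
         ((\<exists>I :: 'i set. iso_closed_subspace_of_real_lines I X \<B>) \<longrightarrow>
            Hausdorff_uniformizable X \<B> \<and> bornologically_realcompact X \<B>)"
proof (intro conjI iffI impI)
  show "\<exists>I :: ('a \<Rightarrow> real) set. iso_closed_subspace_of_real_lines I X \<B>"
    if "Hausdorff_uniformizable X \<B> \<and> bornologically_realcompact X \<B>"
    using Hausdorff_uniformizable_realcompact_imp_iso[OF assms] that by blast
qed (use iso_imp_Hausdorff_uniformizable_realcompact[OF assms] in blast)+

end
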